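(* Let $t_0\in\mathbb{R}$ and $n\ge 1$. Let $A(t,u,v)$, $B(t,u,v)$, $C(t,u,v)$ be complex $n\times n$ matrix-valued functions and $\mu(t,u,v)$ a real-valued scalar function on $[t_0,+\infty)\times\mathbb{C}^n\times\mathbb{C}^n$, all locally integrable in $t$ and continuous in $u$ and $v$, with $B(t,u,v)=B^*(t,u,v)$ for all $t\ge t_0$, $u,v\in\mathbb{C}^n$. Consider the system $$ \begin{cases}\phi' = A(t,\phi,\psi)\phi + B(t,\phi,\psi)\psi,\\ \psi' = C(t,\phi,\psi)\phi + [\mu(t,\phi,\psi) I - A^*(t,\phi,\psi)]\psi,\end{cases}\qquad t\ge t_0, $$ where $I$ is the $n\times n$ identity matrix. Assume that there are locally integrable functions $a_0,b_0,c_0,\mu_0$ on $[t_0,+\infty)$ such that $$ \|A(t,u,v)\|\le a_0(t),\quad \|B(t,u,v)\|\le b_0(t),\quad \|C(t,u,v)\|\le c_0(t),\quad |\mu(t,u,v)|\le\mu_0(t) $$ for all $t\ge t_0$ and $u,v\in\mathbb{C}^n$. If $$ B(t,u,v)\ge 0,\qquad C(t,u,v)+C^*(t,u,v)\ge 0\qquad\text{for all } t\ge t_0,\ u,v\in\mathbb{C}^n, $$ then the system is non oscillatory, that is, it has at least one conjoined solution on $[t_0,+\infty)$, and every conjoined solution $(\phi(t),\psi(t))$ of it is non oscillatory.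
   Context: $M^*$ denotes the conjugate transpose of a matrix $M$; $M\ge 0$ means that the Hermitian matrix $M$ is nonnegative definite; $\|\cdot\|$ is a Euclidean norm on square matrices. "Locally integrable in $t$ and continuous in $u$ and $v$" means: locally integrable as a function of $t\in[t_0,+\infty)$ for each fixed $(u,v)$, and continuous in $(u,v)$ for each fixed $t$. A solution of the system on an interval $[t_1,t_2)\subset[t_0,+\infty)$ (with $t_2=+\infty$ allowed) is an ordered pair $(\phi(t),\psi(t))$ of absolutely continuous $\mathbb{C}^n$-valued functions on $[t_1,t_2)$ satisfying the system almost everywhere on $[t_1,t_2)$. On unbounded intervals, absolute continuity is understood locally, i.e. on compact subintervals. Let $\theta$ denote the zero vector of $\mathbb{C}^n$. Conjoined solution: a solution $(\phi(t),\psi(t))$ existing on $[t_0,+\infty)$ is called conjoined if there exist $t_1\ge t_0$ and a complex $n\times n$ matrix $Y$ with $Y+Y^*\ge 0$ such that $\phi(t_1)\ne\theta$ and $\psi(t_1)=Y\phi(t_1)$. Non oscillatory solution: a solution $(\phi(t),\psi(t))$ existing on $[t_0,+\infty)$ is called non oscillatory if there exists $T\ge t_0$ such that $\phi(t)\ne\theta$ for all $t\ge T$. Nonsingular system: the system is called nonsingular if it has a conjoined solution on $[t_0,+\infty)$. Non oscillatory system: the system is called non oscillatory if it is nonsingular and every conjoined solution of it is non oscillatory. *)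

theory Defs
  imports "HOL-Analysis.Analysis"
begin

definition ctransp :: "complex^'n^'m \<Rightarrow> complex^'m^'n" where
  "ctransp M = (\<chi> i j. cnj (M $ j $ i))"

definition hermitian :: "complex^'n^'n \<Rightarrow> bool" where
  "hermitian M \<longleftrightarrow> ctransp M = M"

(* The quadratic form x^* M x of a Hermitian M is real, so its real part is its value. *)
definition nonneg_definite :: "complex^'n^'n \<Rightarrow> bool" where
  "nonneg_definite M \<longleftrightarrow>
     hermitian M \<and> (\<forall>x. 0 \<le> Re (\<Sum>i\<in>UNIV. cnj (x $ i) * (M *v x) $ i))"

(* Local integrability on [t0, +infinity), in the sense of Lebesgue. *)
definition locally_integrable_from :: "real \<Rightarrow> (real \<Rightarrow> 'a::euclidean_space) \<Rightarrow> bool" where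
  "locally_integrable_from t0 f \<longleftrightarrow> (\<forall>T\<ge>t0. f absolutely_integrable_on {t0..T})"

definition loc_integrable_continuous ::
    "real \<Rightarrow> (real \<Rightarrow> complex^'n \<Rightarrow> complex^'n \<Rightarrow> 'a::euclidean_space) \<Rightarrow> bool" where
  "loc_integrable_continuous t0 F \<longleftrightarrow>
     (\<forall>u v. locally_integrable_from t0 (\<lambda>t. F t u v)) \<and>
     (\<forall>t\<ge>t0. continuous_on UNIV (\<lambda>(u, v). F t u v))"

(* Absolute continuity of functions; absolutely_continuous from HOL-Analysis is about measures.
   A pair (s, r) in P stands for the subinterval with endpoints s and r. *)
definition abs_continuous_on_interval :: "real \<Rightarrow> real \<Rightarrow> (real \<Rightarrow> 'a::real_normed_vector) \<Rightarrow> bool" where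
  "abs_continuous_on_interval a b f \<longleftrightarrow>
     (\<forall>\<epsilon>>0. \<exists>\<delta>>0. \<forall>P. finite P \<longrightarrow>
        (\<forall>(s, r)\<in>P. a \<le> s \<and> s \<le> r \<and> r \<le> b) \<longrightarrow>
        disjoint_family_on (\<lambda>(s, r). {s<..<r}) P \<longrightarrow>
        (\<Sum>(s, r)\<in>P. r - s) < \<delta> \<longrightarrow>
        (\<Sum>(s, r)\<in>P. norm (f r - f s)) < \<epsilon>)"

definition locally_abs_continuous_from :: "real \<Rightarrow> (real \<Rightarrow> 'a::real_normed_vector) \<Rightarrow> bool" where
  "locally_abs_continuous_from t0 f \<longleftrightarrow>
     (\<forall>a b. t0 \<le> a \<longrightarrow> a \<le> b \<longrightarrow> abs_continuous_on_interval a b f)"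

(* Values of the coefficients and of the solution at times before t0 are irrelevant.
   Note that mat c is c times the identity matrix. *)
definition solution_from where
  "solution_from (t0::real)
     (A :: real \<Rightarrow> complex^'n \<Rightarrow> complex^'n \<Rightarrow> complex^'n^'n)
     (B :: real \<Rightarrow> complex^'n \<Rightarrow> complex^'n \<Rightarrow> complex^'n^'n)
     (C :: real \<Rightarrow> complex^'n \<Rightarrow> complex^'n \<Rightarrow> complex^'n^'n)
     (\<mu> :: real \<Rightarrow> complex^'n \<Rightarrow> complex^'n \<Rightarrow> real)
     (\<phi> :: real \<Rightarrow> complex^'n) (\<psi> :: real \<Rightarrow> complex^'n) \<longleftrightarrow>
     locally_abs_continuous_from t0 \<phi> \<and>
     locally_abs_continuous_from t0 \<psi> \<and>
     (AE t in lebesgue. t0 \<le> t \<longrightarrow>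
        (\<phi> has_vector_derivative
           (A t (\<phi> t) (\<psi> t) *v \<phi> t + B t (\<phi> t) (\<psi> t) *v \<psi> t)) (at t within {t0..}) \<and>
        (\<psi> has_vector_derivative
           (C t (\<phi> t) (\<psi> t) *v \<phi> t
            + (mat (complex_of_real (\<mu> t (\<phi> t) (\<psi> t))) - ctransp (A t (\<phi> t) (\<psi> t))) *v \<psi> t))
           (at t within {t0..}))"

definition conjoined_solution where
  "conjoined_solution t0 A B C \<mu> \<phi> \<psi> \<longleftrightarrow>
     solution_from t0 A B C \<mu> \<phi> \<psi> \<and>
     (\<exists>t1\<ge>t0. \<exists>Y. nonneg_definite (Y + ctransp Y) \<and> \<phi> t1 \<noteq> 0 \<and> \<psi> t1 = Y *v \<phi> t1)"

definition nonoscillatory_solution where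
  "nonoscillatory_solution t0 A B C \<mu> \<phi> \<psi> \<longleftrightarrow>
     solution_from t0 A B C \<mu> \<phi> \<psi> \<and> (\<exists>T\<ge>t0. \<forall>t\<ge>T. \<phi> t \<noteq> 0)"

definition nonsingular_system where
  "nonsingular_system t0 A B C \<mu> \<longleftrightarrow> (\<exists>\<phi> \<psi>. conjoined_solution t0 A B C \<mu> \<phi> \<psi>)"

definition nonoscillatory_system where
  "nonoscillatory_system t0 A B C \<mu> \<longleftrightarrow>
     nonsingular_system t0 A B C \<mu> \<and>
     (\<forall>\<phi> \<psi>. conjoined_solution t0 A B C \<mu> \<phi> \<psi> \<longrightarrow> nonoscillatory_solution t0 A B C \<mu> \<phi> \<psi>)"

end

theory Submission
  imports Defs "HOL-Complex_Analysis.Great_Picard"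
begin

text \<open>Along a solution the real function \<open>w = Re (\<phi>\<^sup>* \<psi>)\<close> satisfies \<open>w' = \<psi>\<^sup>* B \<psi> + Re (\<phi>\<^sup>* C \<phi>) + \<mu> w \<ge> \<mu> w\<close>
  almost everywhere, and \<open>w t1 \<ge> 0\<close> for a conjoined solution. Hence \<open>w \<ge> 0\<close> from \<open>t1\<close> on, and there
  \<open>w' \<ge> - \<mu>0 w\<close>, so \<open>w exp (\<integral> \<mu>0)\<close> is nondecreasing. If \<open>\<phi> T = 0\<close> for some \<open>T > t1\<close>, then \<open>w T = 0\<close>, so \<open>w\<close>
  vanishes on \<open>[t1, T]\<close>; therefore \<open>\<psi>\<^sup>* B \<psi> = 0\<close>, whence \<open>B \<psi> = 0\<close> and \<open>\<phi>' = A \<phi>\<close> there, and the Gronwall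
  inequality gives \<open>\<phi> t1 = 0\<close>, a contradiction. Existence of a global solution is Caratheodory's theorem for a
  right-hand side of linear growth.\<close>

section \<open>Absolutely continuous functions\<close>

text \<open>Along a solution the coefficients are compositions with the state, while integrability
  is given only for their majorants. An integrating factor built from
  \<open>\<mu> t (\<phi> t) (\<psi> t)\<close> would first require integrability of that
  composition; one built from \<open>\<mu>0\<close> does not, at the price of a case distinction on
  the sign of w. Where w < 0, \<mu> w is at least \<open>\<mu>0\<close> w; where w \<ge> 0, it is at
  least - \<open>\<mu>0\<close> w. The first bound keeps w nonnegative after t1, and only then can
  the second one carry the value 0 at T back to t1. For the same reason no derivative of a given
  solution is ever integrated: all estimates on it rest on one monotonicity principle, that an
  absolutely continuous function with nonnegative derivative almost everywhere is nondecreasing.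
  Uniqueness cannot be invoked either, since the coefficients are merely continuous in the state;
  existence therefore comes from compactness, and the final contradiction from a Gronwall estimate
  run backward from T.\<close>

lemma abs_continuous_on_intervalE:
  assumes "abs_continuous_on_interval a b f" "0 < \<epsilon>"
  obtains \<delta> where "0 < \<delta>" "\<And>P. finite P \<Longrightarrow> (\<And>s r. (s, r) \<in> P \<Longrightarrow> a \<le> s \<and> s \<le> r \<and> r \<le> b) \<Longrightarrow>
        disjoint_family_on (\<lambda>(s, r). {s<..<r}) P \<Longrightarrow>
        (\<Sum>(s, r)\<in>P. r - s) < \<delta> \<Longrightarrow> (\<Sum>(s, r)\<in>P. norm (f r - f s)) < \<epsilon>"
proof -
  obtain \<delta> where "0 < \<delta>" and \<delta>: "\<forall>P. finite P \<longrightarrow> (\<forall>(s, r)\<in>P. a \<le> s \<and> s \<le> r \<and> r \<le> b) \<longrightarrow>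
        disjoint_family_on (\<lambda>(s, r). {s<..<r}) P \<longrightarrow>
        (\<Sum>(s, r)\<in>P. r - s) < \<delta> \<longrightarrow> (\<Sum>(s, r)\<in>P. norm (f r - f s)) < \<epsilon>"
    using assms(1)[unfolded abs_continuous_on_interval_def, rule_format, OF assms(2)] by (elim exE conjE)
  show thesis
    by (rule that[OF \<open>0 < \<delta>\<close> \<delta>[rule_format]]) auto
qed

lemma abs_continuous_on_intervalI:
  assumes "\<And>\<epsilon>. 0 < \<epsilon> \<Longrightarrow> \<exists>\<delta>>0. \<forall>P. finite P \<longrightarrow> (\<forall>s r. (s, r) \<in> P \<longrightarrow> a \<le> s \<and> s \<le> r \<and> r \<le> b) \<longrightarrow>
        disjoint_family_on (\<lambda>(s, r). {s<..<r}) P \<longrightarrow>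
        (\<Sum>(s, r)\<in>P. r - s) < \<delta> \<longrightarrow> (\<Sum>(s, r)\<in>P. norm (f r - f s)) < \<epsilon>"
  shows "abs_continuous_on_interval a b f"
proof -
  have "(\<forall>(s, r)\<in>P. a \<le> s \<and> s \<le> r \<and> r \<le> b) \<longleftrightarrow> (\<forall>s r. (s, r) \<in> P \<longrightarrow> a \<le> s \<and> s \<le> r \<and> r \<le> b)"
    for P :: "(real \<times> real) set" by auto
  then show ?thesis using assms unfolding abs_continuous_on_interval_def by presburger
qed

lemma abs_continuous_on_subinterval:
  assumes "abs_continuous_on_interval a b f" "a \<le> c" "d \<le> b"
  shows "abs_continuous_on_interval c d f"
proof (rule abs_continuous_on_intervalI)
  fix \<epsilon> :: real assume "\<epsilon> > 0"
  obtain \<delta> where "\<delta> > 0" and \<delta>: "\<And>P. finite P \<Longrightarrow>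
        (\<And>s r. (s, r) \<in> P \<Longrightarrow> a \<le> s \<and> s \<le> r \<and> r \<le> b) \<Longrightarrow>
        disjoint_family_on (\<lambda>(s, r). {s<..<r}) P \<Longrightarrow>
        (\<Sum>(s, r)\<in>P. r - s) < \<delta> \<Longrightarrow> (\<Sum>(s, r)\<in>P. norm (f r - f s)) < \<epsilon>"
    using abs_continuous_on_intervalE[OF assms(1) \<open>\<epsilon> > 0\<close>] by metis
  show "\<exists>\<delta>>0. \<forall>P. finite P \<longrightarrow> (\<forall>s r. (s, r) \<in> P \<longrightarrow> c \<le> s \<and> s \<le> r \<and> r \<le> d) \<longrightarrow>
        disjoint_family_on (\<lambda>(s, r). {s<..<r}) P \<longrightarrow>
        (\<Sum>(s, r)\<in>P. r - s) < \<delta> \<longrightarrow> (\<Sum>(s, r)\<in>P. norm (f r - f s)) < \<epsilon>"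
  proof (intro exI[of _ \<delta>] conjI allI impI \<open>\<delta> > 0\<close> \<delta>)
    fix P s r assume "\<forall>s r. (s, r) \<in> P \<longrightarrow> c \<le> s \<and> s \<le> r \<and> r \<le> d" "(s, r) \<in> P"
    then show "a \<le> s" "s \<le> r" "r \<le> b" using assms(2,3) by fastforce+
  qed auto
qed

text \<open>The closure properties below all bound an increment of the new function by increments of
  known ones over the same interval. Two majorants are allowed for the sake of products; a single
  one is entered twice.\<close>

lemma abs_continuous_on_dominated:
  fixes f :: "real \<Rightarrow> 'a::real_normed_vector" and g :: "real \<Rightarrow> 'b::real_normed_vector"
    and h :: "real \<Rightarrow> 'c::real_normed_vector"
  assumes f: "abs_continuous_on_interval a b f" and g: "abs_continuous_on_interval a b g"
    and h: "\<And>s r. a \<le> s \<Longrightarrow> s \<le> r \<Longrightarrow> r \<le> b \<Longrightarrow>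
              norm (h r - h s) \<le> K * (norm (f r - f s) + norm (g r - g s))"
  shows "abs_continuous_on_interval a b h"
proof (rule abs_continuous_on_intervalI)
  fix \<epsilon> :: real assume "\<epsilon> > 0"
  \<comment> \<open>\<open>\<bar>K\<bar> + 1\<close> is positive whatever \<open>K\<close> is, and
    the 2 shares \<epsilon> between the two majorants.\<close>
  define \<eta> where "\<eta> = \<epsilon> / (2 * (\<bar>K\<bar> + 1))"
  have "\<eta> > 0" using \<open>\<epsilon> > 0\<close> by (simp add: \<eta>_def)
  obtain \<delta>f where "\<delta>f > 0" and \<delta>f: "\<And>P. finite P \<Longrightarrow>
        (\<And>s r. (s, r) \<in> P \<Longrightarrow> a \<le> s \<and> s \<le> r \<and> r \<le> b) \<Longrightarrow>
        disjoint_family_on (\<lambda>(s, r). {s<..<r}) P \<Longrightarrow>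
        (\<Sum>(s, r)\<in>P. r - s) < \<delta>f \<Longrightarrow> (\<Sum>(s, r)\<in>P. norm (f r - f s)) < \<eta>"
    using abs_continuous_on_intervalE[OF f \<open>\<eta> > 0\<close>] by metis
  obtain \<delta>g where "\<delta>g > 0" and \<delta>g: "\<And>P. finite P \<Longrightarrow>
        (\<And>s r. (s, r) \<in> P \<Longrightarrow> a \<le> s \<and> s \<le> r \<and> r \<le> b) \<Longrightarrow>
        disjoint_family_on (\<lambda>(s, r). {s<..<r}) P \<Longrightarrow>
        (\<Sum>(s, r)\<in>P. r - s) < \<delta>g \<Longrightarrow> (\<Sum>(s, r)\<in>P. norm (g r - g s)) < \<eta>"
    using abs_continuous_on_intervalE[OF g \<open>\<eta> > 0\<close>] by metis
  show "\<exists>\<delta>>0. \<forall>P. finite P \<longrightarrow> (\<forall>s r. (s, r) \<in> P \<longrightarrow> a \<le> s \<and> s \<le> r \<and> r \<le> b) \<longrightarrow>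
        disjoint_family_on (\<lambda>(s, r). {s<..<r}) P \<longrightarrow>
        (\<Sum>(s, r)\<in>P. r - s) < \<delta> \<longrightarrow> (\<Sum>(s, r)\<in>P. norm (h r - h s)) < \<epsilon>"
  proof (intro exI[of _ "min \<delta>f \<delta>g"] conjI allI impI)
    fix P assume P: "finite P" "\<forall>s r. (s, r) \<in> P \<longrightarrow> a \<le> s \<and> s \<le> r \<and> r \<le> b"
        "disjoint_family_on (\<lambda>(s, r). {s<..<r}) P" "(\<Sum>(s, r)\<in>P. r - s) < min \<delta>f \<delta>g"
    have "(\<Sum>(s, r)\<in>P. norm (h r - h s))
        \<le> (\<Sum>(s, r)\<in>P. (\<bar>K\<bar> + 1) * (norm (f r - f s) + norm (g r - g s)))"
    proof (rule sum_mono, clarify)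
      fix s r assume "(s, r) \<in> P"
      then have "norm (h r - h s) \<le> K * (norm (f r - f s) + norm (g r - g s))"
        using P(2) h by blast
      also have "\<dots> \<le> (\<bar>K\<bar> + 1) * (norm (f r - f s) + norm (g r - g s))"
        by (intro mult_right_mono) auto
      finally show "norm (h r - h s) \<le> (\<bar>K\<bar> + 1) * (norm (f r - f s) + norm (g r - g s))" .
    qed
    also have "\<dots> = (\<bar>K\<bar> + 1) * ((\<Sum>(s, r)\<in>P. norm (f r - f s)) + (\<Sum>(s, r)\<in>P. norm (g r - g s)))"
      by (simp add: case_prod_unfold sum.distrib flip: sum_distrib_left)
    also have "\<dots> < (\<bar>K\<bar> + 1) * (\<eta> + \<eta>)"
      using \<delta>f[OF P(1) P(2)[rule_format] P(3)] \<delta>g[OF P(1) P(2)[rule_format] P(3)] P(4) by (intro mult_strict_left_mono add_strict_mono) auto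
    also have "\<dots> = \<epsilon>"
    proof -
      have *: "L * (\<epsilon> / (2 * L) + \<epsilon> / (2 * L)) = \<epsilon>" if "0 < L" for L :: real
        using that by (simp add: field_simps)
      show ?thesis unfolding \<eta>_def by (rule *) simp
    qed
    finally show "(\<Sum>(s, r)\<in>P. norm (h r - h s)) < \<epsilon>" .
  qed (use \<open>\<delta>f > 0\<close> \<open>\<delta>g > 0\<close> in auto)
qed

lemma abs_continuous_imp_continuous_on:
  assumes "abs_continuous_on_interval a b f"
  shows "continuous_on {a..b} f"
  unfolding continuous_on_iff
proof (intro ballI allI impI)
  fix x and \<epsilon> :: real assume x: "x \<in> {a..b}" and "\<epsilon> > 0"
  obtain \<delta> where "\<delta> > 0" and \<delta>: "\<And>P. finite P \<Longrightarrow>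
        (\<And>s r. (s, r) \<in> P \<Longrightarrow> a \<le> s \<and> s \<le> r \<and> r \<le> b) \<Longrightarrow>
        disjoint_family_on (\<lambda>(s, r). {s<..<r}) P \<Longrightarrow>
        (\<Sum>(s, r)\<in>P. r - s) < \<delta> \<Longrightarrow> (\<Sum>(s, r)\<in>P. norm (f r - f s)) < \<epsilon>"
    using abs_continuous_on_intervalE[OF assms \<open>\<epsilon> > 0\<close>] by metis
  \<comment> \<open>A family of one interval turns absolute continuity into uniform
    continuity.\<close>
  have *: "norm (f r - f s) < \<epsilon>" if "a \<le> s" "s \<le> r" "r \<le> b" "r - s < \<delta>" for r s
    using \<delta>[of "{(s, r)}"] that by (simp add: disjoint_family_on_def)
  show "\<exists>d>0. \<forall>y\<in>{a..b}. dist y x < d \<longrightarrow> dist (f y) (f x) < \<epsilon>"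
  proof (intro exI[of _ \<delta>] conjI ballI impI \<open>\<delta> > 0\<close>)
    fix y assume "y \<in> {a..b}" "dist y x < \<delta>"
    then show "dist (f y) (f x) < \<epsilon>"
      using *[of x y] *[of y x] x by (cases "x \<le> y") (auto simp: dist_norm norm_minus_commute)
  qed
qed

lemma abs_continuous_on_linear:
  assumes "bounded_linear h" and f: "abs_continuous_on_interval a b f"
  shows "abs_continuous_on_interval a b (\<lambda>t. h (f t))"
proof -
  interpret bounded_linear h by fact
  obtain K where "K > 0" and K: "\<And>x. norm (h x) \<le> norm x * K" using pos_bounded by blast
  show ?thesis
  proof (rule abs_continuous_on_dominated[OF f f])
    fix s r
    have "norm (h (f r) - h (f s)) \<le> K * norm (f r - f s)"
      using K[of "f r - f s"] by (simp add: diff mult.commute)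
    also have "\<dots> \<le> K * (norm (f r - f s) + norm (f r - f s))"
      using \<open>K > 0\<close> by (intro mult_left_mono) auto
    finally show "norm (h (f r) - h (f s)) \<le> K * (norm (f r - f s) + norm (f r - f s))" .
  qed
qed

text \<open>The increment of a product splits into two terms, each the increment of one factor
  against a value of the other, and the values are bounded because both factors are continuous on a
  compact interval. Needed for \<open>\<phi> \<bullet> \<psi>\<close>, for
  \<open>\<phi> \<bullet> \<phi>\<close> and for products with an integrating factor.\<close>

lemma abs_continuous_on_bilinear:
  fixes f :: "real \<Rightarrow> 'a::real_normed_vector" and g :: "real \<Rightarrow> 'b::real_normed_vector"
  assumes "bounded_bilinear bil"
    and f: "abs_continuous_on_interval a b f" and g: "abs_continuous_on_interval a b g"
  shows "abs_continuous_on_interval a b (\<lambda>t. bil (f t) (g t))"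
proof -
  interpret bounded_bilinear bil by fact
  obtain K where "K > 0" and K: "\<And>x y. norm (bil x y) \<le> norm x * norm y * K"
    using pos_bounded by blast
  have "bounded (f ` {a..b})" "bounded (g ` {a..b})"
    using f g by (auto intro!: compact_imp_bounded compact_continuous_image
        abs_continuous_imp_continuous_on)
  then obtain Bf Bg where "Bf > 0" "Bg > 0" and B: "\<And>t. t \<in> {a..b} \<Longrightarrow> norm (f t) \<le> Bf"
      "\<And>t. t \<in> {a..b} \<Longrightarrow> norm (g t) \<le> Bg"
    by (auto simp: bounded_pos)
  show ?thesis
  proof (rule abs_continuous_on_dominated[OF f g, where K="(Bf + Bg) * K"])
    fix s r assume sr: "a \<le> s" "s \<le> r" "r \<le> b"
    have "bil (f r) (g r) - bil (f s) (g s) = bil (f r) (g r - g s) + bil (f r - f s) (g s)"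
      by (simp add: diff_left diff_right)
    then have "norm (bil (f r) (g r) - bil (f s) (g s))
        \<le> norm (f r) * norm (g r - g s) * K + norm (f r - f s) * norm (g s) * K"
      using K[of "f r" "g r - g s"] K[of "f r - f s" "g s"] by (metis add_mono norm_triangle_le)
    also have "\<dots> \<le> (Bf + Bg) * norm (g r - g s) * K + norm (f r - f s) * (Bf + Bg) * K"
      using B(1)[of r] B(2)[of s] sr \<open>K > 0\<close> \<open>Bf > 0\<close> \<open>Bg > 0\<close>
      by (intro add_mono mult_right_mono mult_left_mono) auto
    finally show "norm (bil (f r) (g r) - bil (f s) (g s))
        \<le> (Bf + Bg) * K * (norm (f r - f s) + norm (g r - g s))"
      by (simp add: algebra_simps)
  qed
qed

section \<open>Indefinite integrals\<close>

text \<open>The nondegenerate closed intervals meet at most in endpoints, hence form a division of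
  their union, and the integral of a nonnegative function grows with the domain.\<close>

lemma sum_integral_disjoint_intervals_le:
  fixes h :: "real \<Rightarrow> real"
  assumes h: "h integrable_on {a..b}" "\<And>x. x \<in> {a..b} \<Longrightarrow> 0 \<le> h x"
    and P: "finite P" "\<And>s r. (s, r) \<in> P \<Longrightarrow> a \<le> s \<and> s \<le> r \<and> r \<le> b"
      "disjoint_family_on (\<lambda>(s, r). {s<..<r}) P"
  shows "(\<Sum>(s, r)\<in>P. integral {s..r} h) \<le> integral {a..b} h"
proof -
  define Q where "Q = {(s, r) \<in> P. s < r}"
  define I :: "real \<times> real \<Rightarrow> real set" where "I = (\<lambda>(s, r). {s..r})"
  have "finite Q" using P(1) by (auto simp: Q_def intro: finite_subset)
  have inj: "inj_on I Q"
    by (auto simp: inj_on_def I_def Q_def Icc_eq_Icc)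
  have div: "I ` Q division_of \<Union>(I ` Q)"
    unfolding division_of_def
  proof (intro conjI ballI allI impI)
    show "finite (I ` Q)" using \<open>finite Q\<close> by simp
  next
    fix K assume "K \<in> I ` Q"
    then show "K \<subseteq> \<Union>(I ` Q)" "K \<noteq> {}" "\<exists>a b. K = cbox a b"
      by (auto simp: I_def Q_def)
  next
    fix K L assume "K \<in> I ` Q" "L \<in> I ` Q" "K \<noteq> L"
    then obtain p q where pq: "p \<in> Q" "q \<in> Q" "p \<noteq> q" "K = I p" "L = I q" by auto
    then show "interior K \<inter> interior L = {}"
      using P(3) by (fastforce simp: I_def Q_def disjoint_family_on_def interior_atLeastAtMost_real)
  qed auto
  have hI: "h integrable_on K" if "K \<in> I ` Q" for K
    using that P(2) h(1) by (fastforce simp: I_def Q_def intro: integrable_on_subinterval)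
  have "(\<Sum>(s, r)\<in>P. integral {s..r} h) = (\<Sum>p\<in>Q. integral (I p) h)"
    unfolding I_def case_prod_unfold
    by (rule sum.mono_neutral_right) (use P in \<open>force simp: Q_def\<close>)+
  also have "\<dots> = (\<Sum>K\<in>I ` Q. integral K h)"
    by (simp add: sum.reindex[OF inj])
  also have "\<dots> = integral (\<Union>(I ` Q)) h"
    using integral_combine_division_bottomup[OF div hI] by simp
  also have "\<dots> \<le> integral {a..b} h"
  proof (rule integral_subset_le)
    show "\<Union>(I ` Q) \<subseteq> {a..b}" using P(2) by (fastforce simp: I_def Q_def)
    show "h integrable_on \<Union>(I ` Q)"
      using has_integral_combine_division[OF div, of h "\<lambda>K. integral K h"] hI
      by (blast intro: integrable_integral has_integral_integrable)
  qed (use h in auto)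
  finally show ?thesis .
qed

text \<open>A bounded integrand would give a Lipschitz function. So the norm of \<open>f\<close> is
  cut at a height k: the part below the cut contributes at most k times the total length, and the
  part above it has integral less than \<epsilon>/2 over all of \<open>{a..b}\<close> once k is
  large, whatever the family of intervals.\<close>

lemma abs_continuous_on_indefinite_integral:
  fixes f :: "real \<Rightarrow> 'a::euclidean_space"
  assumes f: "f absolutely_integrable_on {a..b}"
  shows "abs_continuous_on_interval a b (\<lambda>t. integral {a..t} f)"
proof (rule abs_continuous_on_intervalI)
  fix \<epsilon> :: real assume "\<epsilon> > 0"
  have nf: "(\<lambda>x. norm (f x)) absolutely_integrable_on {a..b}"
    using f by (rule absolutely_integrable_norm[unfolded o_def])
  define h where "h k x = norm (f x) - min (norm (f x)) (real k)" for k x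
  have min_int: "(\<lambda>x. min (norm (f x)) (real k)) absolutely_integrable_on {a..b}" for k
    by (intro absolutely_integrable_min_1 nf absolutely_integrable_on_const) auto
  have h_int: "h k integrable_on {a..b}" for k
    unfolding h_def
    using nf min_int by (intro integrable_diff) (auto simp: absolutely_integrable_on_def)
  have "(\<lambda>k. integral {a..b} (h k)) \<longlonglongrightarrow> integral {a..b} (\<lambda>x. 0)"
  proof (rule dominated_convergence(2))
    show "(\<lambda>x. norm (f x)) integrable_on {a..b}"
      using f by (simp add: absolutely_integrable_on_def)
    show "norm (h k x) \<le> norm (f x)" for k x by (auto simp: h_def)
    show "(\<lambda>k. h k x) \<longlonglongrightarrow> 0" for x
    proof (rule tendsto_eventually, rule eventually_sequentiallyI)
      fix k assume "nat \<lceil>norm (f x)\<rceil> \<le> k"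
      then have "norm (f x) \<le> real k" by linarith
      then show "h k x = 0" by (simp add: h_def)
    qed
  qed (rule h_int)
  then have "eventually (\<lambda>k. integral {a..b} (h k) < \<epsilon> / 2) sequentially"
    using \<open>\<epsilon> > 0\<close> by (intro order_tendstoD) auto
  then obtain k where k: "integral {a..b} (h k) < \<epsilon> / 2"
    by (metis eventually_sequentially order_refl)
  show "\<exists>\<delta>>0. \<forall>P. finite P \<longrightarrow> (\<forall>s r. (s, r) \<in> P \<longrightarrow> a \<le> s \<and> s \<le> r \<and> r \<le> b) \<longrightarrow>
        disjoint_family_on (\<lambda>(s, r). {s<..<r}) P \<longrightarrow> (\<Sum>(s, r)\<in>P. r - s) < \<delta> \<longrightarrow>
        (\<Sum>(s, r)\<in>P. norm (integral {a..r} f - integral {a..s} f)) < \<epsilon>"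
  \<comment> \<open>Half of \<epsilon> is left for the part below the cut; the divisor has k + 1
    because k may be 0.\<close>
  proof (intro exI[of _ "\<epsilon> / (2 * (real k + 1))"] conjI allI impI)
    fix P assume P: "finite P" "\<forall>s r. (s, r) \<in> P \<longrightarrow> a \<le> s \<and> s \<le> r \<and> r \<le> b"
        "disjoint_family_on (\<lambda>(s, r). {s<..<r}) P"
      and len: "(\<Sum>(s, r)\<in>P. r - s) < \<epsilon> / (2 * (real k + 1))"
    have "(\<Sum>(s, r)\<in>P. norm (integral {a..r} f - integral {a..s} f))
        \<le> (\<Sum>(s, r)\<in>P. real k * (r - s) + integral {s..r} (h k))"
    proof (rule sum_mono, clarify)
      fix s r assume "(s, r) \<in> P"
      then have sr: "a \<le> s" "s \<le> r" "r \<le> b" using P(2) by auto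
      then have sub: "{s..r} \<subseteq> {a..b}" by auto
      have fsr: "f absolutely_integrable_on {s..r}" "f integrable_on {a..r}"
        using f sr by (auto intro: absolutely_integrable_on_subinterval integrable_on_subinterval
            set_lebesgue_integral_eq_integral(1))
      have "integral {a..r} f - integral {a..s} f = integral {s..r} f"
        using Henstock_Kurzweil_Integration.integral_combine[OF sr(1,2) fsr(2)] by (simp add: algebra_simps)
      also have "norm \<dots> \<le> integral {s..r} (\<lambda>x. norm (f x))"
        using fsr(1) by (rule absolutely_integrable_on_def[THEN iffD1, THEN conjunct1, THEN integral_norm_bound_integral])
          (use fsr(1) in \<open>auto simp: absolutely_integrable_on_def\<close>)
      also have "\<dots> \<le> integral {s..r} (\<lambda>x. real k + h k x)"
      proof (rule integral_le)
        show "(\<lambda>x. real k + h k x) integrable_on {s..r}"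
          using integrable_on_subinterval[OF h_int sub] by (intro integrable_add) auto
      qed (use fsr(1) in \<open>auto simp: absolutely_integrable_on_def h_def\<close>)
      also have "\<dots> = real k * (r - s) + integral {s..r} (h k)"
        using integrable_on_subinterval[OF h_int sub] sr
        by (subst integral_add) auto
      finally show "norm (integral {a..r} f - integral {a..s} f)
          \<le> real k * (r - s) + integral {s..r} (h k)" .
    qed
    also have "\<dots> = real k * (\<Sum>(s, r)\<in>P. r - s) + (\<Sum>(s, r)\<in>P. integral {s..r} (h k))"
      by (simp add: case_prod_unfold sum.distrib sum_distrib_left)
    also have "\<dots> \<le> (real k + 1) * (\<epsilon> / (2 * (real k + 1))) + integral {a..b} (h k)"
    proof (rule add_mono)
      have "real k * (\<Sum>(s, r)\<in>P. r - s) \<le> real k * (\<epsilon> / (2 * (real k + 1)))"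
        using len by (intro mult_left_mono) auto
      also have "\<dots> \<le> (real k + 1) * (\<epsilon> / (2 * (real k + 1)))"
        using \<open>\<epsilon> > 0\<close> by (intro mult_right_mono) auto
      finally show "real k * (\<Sum>(s, r)\<in>P. r - s) \<le> (real k + 1) * (\<epsilon> / (2 * (real k + 1)))" .
    qed (rule sum_integral_disjoint_intervals_le[OF h_int _ P(1) P(2)[rule_format] P(3)], simp add: h_def)
    also have "(real k + 1) * (\<epsilon> / (2 * (real k + 1))) = \<epsilon> / 2" by (simp add: field_simps)
    also have "\<epsilon> / 2 + integral {a..b} (h k) < \<epsilon>" using k by linarith
    finally show "(\<Sum>(s, r)\<in>P. norm (integral {a..r} f - integral {a..s} f)) < \<epsilon>" .
  qed (use \<open>\<epsilon> > 0\<close> in auto)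
qed

text \<open>The library has the right derivative of an indefinite integral; the left one follows by reflection.\<close>

lemma indefinite_integral_has_vector_derivative_ae:
  fixes f :: "real \<Rightarrow> 'a::euclidean_space"
  assumes "\<And>b. f integrable_on {a..b}"
  obtains N where "negligible N"
    "\<And>x. a \<le> x \<Longrightarrow> x \<notin> N \<Longrightarrow> ((\<lambda>t. integral {a..t} f) has_vector_derivative f x) (at x within {a..})"
proof -
  \<comment> \<open>Extended by zero to the left of \<open>a\<close>, the integrand is integrable on
    every interval, as \<open>integrable_ccontinuous_explicit\<close> demands, and so is its
    reflection.\<close>
  define g where "g x = (if a \<le> x then f x else 0)" for x
  have g: "g integrable_on {c..d}" for c d
  proof -
    have "g integrable_on {c..a}"
      by (rule integrable_spike[where f="\<lambda>_. 0" and S="{a}"]) (auto simp: g_def)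
    moreover have "g integrable_on {a..d}"
      using assms by (rule integrable_eq) (auto simp: g_def)
    ultimately show ?thesis
    proof (cases "c \<le> a \<and> a \<le> d")
      case True
      with \<open>g integrable_on {c..a}\<close> \<open>g integrable_on {a..d}\<close> show ?thesis
        by (meson Henstock_Kurzweil_Integration.integrable_combine)
    next
      case False
      then have "{c..d} \<subseteq> {c..a} \<or> {c..d} \<subseteq> {a..d}" by auto
      with \<open>g integrable_on {c..a}\<close> \<open>g integrable_on {a..d}\<close> show ?thesis
        by (metis integrable_on_subinterval)
    qed
  qed
  obtain N1 where N1: "negligible N1" "\<And>x e. x \<notin> N1 \<Longrightarrow> 0 < e \<Longrightarrow> \<exists>d>0. \<forall>h. 0 < h \<and> h < d \<longrightarrow>
      norm (integral {x..x + h} g /\<^sub>R h - g x) < e"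
    using integrable_ccontinuous_explicit[of g] g by auto
  have gm: "(\<lambda>x. g (- x)) integrable_on {c..d}" for c d
    using Henstock_Kurzweil_Integration.integrable_reflect_real[where f=g and a="-d" and b="-c"] g by simp
  obtain N2 where N2: "negligible N2" "\<And>x e. x \<notin> N2 \<Longrightarrow> 0 < e \<Longrightarrow> \<exists>d>0. \<forall>h. 0 < h \<and> h < d \<longrightarrow>
      norm (integral {x..x + h} (\<lambda>x. g (- x)) /\<^sub>R h - g (- x)) < e"
    using integrable_ccontinuous_explicit[of "\<lambda>x. g (- x)"] gm by auto
  show thesis
  \<comment> \<open>\<open>N2\<close> collects bad points of the reflected function, so it has to be
    reflected back.\<close>
  proof (rule that[of "N1 \<union> uminus ` N2"])
    show "negligible (N1 \<union> uminus ` N2)"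
      using N1(1) N2(1) by (auto intro!: negligible_Un negligible_differentiable_image_negligible derivative_intros)
  next
    fix x assume "a \<le> x" and x: "x \<notin> N1 \<union> uminus ` N2"
    then have x1: "x \<notin> N1" and x2: "- x \<notin> N2" by (auto simp: image_iff)
    have gf: "integral {a..t} f = integral {a..t} g" for t
      by (rule integral_cong) (auto simp: g_def)
    have right: "integral {a..t} g - integral {a..x} g = integral {x..t} g" if "x \<le> t" for t
      using Henstock_Kurzweil_Integration.integral_combine[OF \<open>a \<le> x\<close> that g] by (simp add: algebra_simps)
    have left: "integral {a..x} g - integral {a..t} g = integral {t..x} g" if "a \<le> t" "t \<le> x" for t
      using Henstock_Kurzweil_Integration.integral_combine[OF that g] by (simp add: algebra_simps)
    show "((\<lambda>t. integral {a..t} f) has_vector_derivative f x) (at x within {a..})"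
      unfolding gf has_vector_derivative_def has_derivative_within_alt
    proof (intro conjI allI impI bounded_linear_scaleR_left)
      fix e :: real assume "e > 0"
      obtain d1 where d1: "d1 > 0" "\<And>h. 0 < h \<Longrightarrow> h < d1 \<Longrightarrow> norm (integral {x..x + h} g /\<^sub>R h - g x) < e"
        using N1(2)[OF x1 \<open>e > 0\<close>] by auto
      obtain d2 where d2: "d2 > 0" "\<And>h. 0 < h \<Longrightarrow> h < d2 \<Longrightarrow>
          norm (integral {-x..-x + h} (\<lambda>x. g (- x)) /\<^sub>R h - g x) < e"
        using N2(2)[OF x2 \<open>e > 0\<close>] by auto
      have scale: "norm (i - h *\<^sub>R y) \<le> e * h" if "0 < h" "norm (i /\<^sub>R h - y) < e" for i y :: 'a and h
      proof -
        have "i - h *\<^sub>R y = h *\<^sub>R (i /\<^sub>R h - y)" using that(1) by (simp add: algebra_simps)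
        then have "norm (i - h *\<^sub>R y) = h * norm (i /\<^sub>R h - y)" using that(1) by simp
        then show ?thesis using that by (simp add: mult.commute)
      qed
      show "\<exists>d>0. \<forall>y\<in>{a..}. norm (y - x) < d \<longrightarrow>
          norm (integral {a..y} g - integral {a..x} g - (y - x) *\<^sub>R f x) \<le> e * norm (y - x)"
      proof (intro exI[of _ "min d1 d2"] conjI ballI impI)
        fix y assume y: "y \<in> {a..}" "norm (y - x) < min d1 d2"
        have fg: "f x = g x" using \<open>a \<le> x\<close> by (simp add: g_def)
        consider "y = x" | "x < y" | "y < x" by linarith
        then show "norm (integral {a..y} g - integral {a..x} g - (y - x) *\<^sub>R f x) \<le> e * norm (y - x)"
        proof cases
          case 2
          then show ?thesis
            using scale[OF _ d1(2)[of "y - x"]] right[of y] y by (simp add: fg)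
        next
          case 3
          have "integral {-x..-x + (x - y)} (\<lambda>x. g (- x)) = integral {y..x} g"
            using Henstock_Kurzweil_Integration.integral_reflect_real[of x y g] by simp
          then have "norm (integral {y..x} g - (x - y) *\<^sub>R g x) \<le> e * (x - y)"
            using 3 y d2(2)[of "x - y"] by (intro scale) auto
          moreover have "integral {a..y} g - integral {a..x} g - (y - x) *\<^sub>R g x
              = - (integral {y..x} g - (x - y) *\<^sub>R g x)"
            using left[of y] 3 y by (simp add: algebra_simps)
          ultimately show ?thesis using 3 by (simp add: fg norm_minus_commute)
        qed auto
      qed (use d1 d2 in auto)
    qed
  qed
qed

text \<open>Take a tagged division fine for a gauge that uses the derivative off \<open>N\<close> and a small open
  cover of \<open>N\<close> on it; on the intervals tagged in \<open>N\<close> absolute continuity bounds the variation.\<close>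

lemma abs_continuous_on_nonneg_derivative_imp_le:
  fixes f :: "real \<Rightarrow> real"
  assumes f: "abs_continuous_on_interval a b f" and "a \<le> b" and N: "negligible N"
    and deriv: "\<And>x. x \<in> {a..b} - N \<Longrightarrow> \<exists>d\<ge>0. (f has_vector_derivative d) (at x within {a..b})"
  shows "f a \<le> f b"
proof (rule field_le_epsilon)
  fix e :: real assume "e > 0"
  \<comment> \<open>The intervals tagged off \<open>N\<close> lose at most
    \<open>\<epsilon> * (b - a)\<close> and the others at most \<epsilon>, which together is
    \<open>e\<close>.\<close>
  define \<epsilon> where "\<epsilon> = e / (b - a + 1)"
  have "\<epsilon> > 0" using \<open>e > 0\<close> \<open>a \<le> b\<close> by (simp add: \<epsilon>_def)
  obtain \<delta> where "0 < \<delta>" and \<delta>: "\<And>P. finite P \<Longrightarrow> (\<And>s r. (s, r) \<in> P \<Longrightarrow> a \<le> s \<and> s \<le> r \<and> r \<le> b) \<Longrightarrow>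
        disjoint_family_on (\<lambda>(s, r). {s<..<r}) P \<Longrightarrow>
        (\<Sum>(s, r)\<in>P. r - s) < \<delta> \<Longrightarrow> (\<Sum>(s, r)\<in>P. norm (f r - f s)) < \<epsilon>"
    using abs_continuous_on_intervalE[OF f \<open>\<epsilon> > 0\<close>] by metis
  obtain U where "open U" "N \<subseteq> U" "U - N \<in> lmeasurable" and UN: "emeasure lebesgue (U - N) < ennreal \<delta>"
    using sets_lebesgue_outer_open[OF negligible_imp_sets[OF N] \<open>0 < \<delta>\<close>] .
  have U: "U \<in> lmeasurable" "measure lebesgue U < \<delta>"
  proof -
    have "measure lebesgue (U - N) < \<delta>"
      using UN \<open>U - N \<in> lmeasurable\<close> \<open>0 < \<delta>\<close>
      by (simp add: emeasure_eq_measure2 ennreal_less_iff)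
    moreover have eq: "U = (U - N) \<union> N" using \<open>N \<subseteq> U\<close> by auto
    moreover have "measure lebesgue ((U - N) \<union> N) \<le> measure lebesgue (U - N) + measure lebesgue N"
      using \<open>U - N \<in> lmeasurable\<close> N by (intro measure_Un_le) (auto dest: fmeasurableD negligible_imp_sets)
    moreover have "measure lebesgue N = 0" using N by (rule negligible_imp_measure0)
    ultimately show "measure lebesgue U < \<delta>" by simp
    show "U \<in> lmeasurable"
      by (subst eq) (intro fmeasurable.Un \<open>U - N \<in> lmeasurable\<close> negligible_imp_measurable N)
  qed
  \<comment> \<open>The factor \<open>sgn (y - x)\<close> covers both sides of x at once: from left
    to right, f drops by at most \<epsilon> times the distance.\<close>
  have "\<exists>\<rho>>0. \<forall>y\<in>{a..b}. \<bar>y - x\<bar> < \<rho> \<longrightarrow> (f y - f x) * sgn (y - x) \<ge> - \<epsilon> * \<bar>y - x\<bar>"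
    if x: "x \<in> {a..b} - N" for x
  proof -
    obtain d where "d \<ge> 0" and d: "(f has_vector_derivative d) (at x within {a..b})"
      using deriv[OF x] by auto
    then obtain \<rho> where "\<rho> > 0" and \<rho>: "\<And>y. y \<in> {a..b} \<Longrightarrow> \<bar>y - x\<bar> < \<rho> \<Longrightarrow>
        \<bar>f y - f x - (y - x) * d\<bar> \<le> \<epsilon> * \<bar>y - x\<bar>"
      using \<open>\<epsilon> > 0\<close> unfolding has_vector_derivative_def has_derivative_within_alt by fastforce
    have "(f y - f x) * sgn (y - x) \<ge> - \<epsilon> * \<bar>y - x\<bar>" if "y \<in> {a..b}" "\<bar>y - x\<bar> < \<rho>" for y
    proof -
      have "0 \<le> (y - x) * d * sgn (y - x)"
        using \<open>d \<ge> 0\<close> by (simp add: sgn_real_def mult_nonneg_nonneg mult_nonpos_nonneg)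
      moreover have "\<bar>(f y - f x - (y - x) * d) * sgn (y - x)\<bar> \<le> \<epsilon> * \<bar>y - x\<bar>"
        using \<rho>[OF that] by (cases "y = x") (simp_all add: abs_mult abs_sgn_eq)
      ultimately show ?thesis by (simp add: algebra_simps abs_le_iff)
    qed
    with \<open>\<rho> > 0\<close> show ?thesis by blast
  qed
  then obtain \<rho> where \<rho>: "\<And>x. x \<in> {a..b} - N \<Longrightarrow> \<rho> x > 0"
      "\<And>x y. x \<in> {a..b} - N \<Longrightarrow> y \<in> {a..b} \<Longrightarrow> \<bar>y - x\<bar> < \<rho> x \<Longrightarrow>
        (f y - f x) * sgn (y - x) \<ge> - \<epsilon> * \<bar>y - x\<bar>"
    by metis
  define \<gamma> where "\<gamma> x = (if x \<in> N then U else if x \<in> {a..b} then ball x (\<rho> x) else UNIV)" for x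
  have "gauge \<gamma>"
    using \<open>open U\<close> \<open>N \<subseteq> U\<close> \<rho>(1) by (auto simp: gauge_def \<gamma>_def)
  then obtain p where p: "p tagged_division_of {a..b}" "\<gamma> fine p"
    by (rule fine_division_exists_real)
  note pD = tagged_division_ofD[OF p(1)]
  have K: "\<exists>s r. K = {s..r} \<and> a \<le> s \<and> s \<le> x \<and> x \<le> r \<and> r \<le> b" if "(x, K) \<in> p" for x K
    using pD(2,3,4)[OF that] by fastforce
  \<comment> \<open>With \<open>Inf K < Sup K\<close> the open intervals are nonempty, so that
    disjoint interiors make \<open>g\<close> injective on \<open>A\<close>. The degenerate intervals
    left out contribute a zero increment.\<close>
  define A where "A = {(x, K) \<in> p. x \<in> N \<and> Inf K < Sup K}"
  define g where "g = (\<lambda>(x::real, K::real set). (Inf K, Sup K))"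
  have "finite A" using pD(1) by (auto simp: A_def intro: finite_subset)
  have disj: "{Inf K<..<Sup K} \<inter> {Inf L<..<Sup L} = {}"
    if "(x, K) \<in> p" "(y, L) \<in> p" "(x, K) \<noteq> (y, L)" for x K y L
    using pD(5)[OF that] K[OF that(1)] K[OF that(2)] by (auto simp: interior_atLeastAtMost_real)
  have inj: "inj_on g A"
  proof (rule inj_onI, rule ccontr)
    fix u v assume "u \<in> A" "v \<in> A" "g u = g v" "u \<noteq> v"
    then show False
      using disj[of "fst u" "snd u" "fst v" "snd v"]
      by (auto simp: A_def g_def)
  qed
  have gA: "a \<le> s \<and> s \<le> r \<and> r \<le> b \<and> {s..r} \<subseteq> U" if srA: "(s, r) \<in> g ` A" for s r
  proof -
    obtain x K' where xK: "(x, K') \<in> p" "x \<in> N" "s = Inf K'" "r = Sup K'"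
      using srA by (auto simp: A_def g_def)
    then have "K' \<subseteq> U" using p(2) by (force simp: fine_def \<gamma>_def)
    then show ?thesis using K[OF xK(1)] xK by auto
  qed
  have disjA: "disjoint_family_on (\<lambda>(s, r). {s<..<r}) (g ` A)"
    unfolding disjoint_family_on_def
  proof (intro ballI impI)
    fix u v assume "u \<in> g ` A" "v \<in> g ` A" "u \<noteq> v"
    then show "(case u of (s, r) \<Rightarrow> {s<..<r}) \<inter> (case v of (s, r) \<Rightarrow> {s<..<r}) = {}"
      using disj by (fastforce simp: A_def g_def)
  qed
  have "(\<Sum>(s, r)\<in>g ` A. norm (f r - f s)) < \<epsilon>"
  proof (rule \<delta>)
    have int_U: "indicat_real U integrable_on {c..d}" for c d
      using U(1) by (metis integrable_on_indicator fmeasurable.Int lmeasurable_interval(1) Int_commute)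
    \<comment> \<open>Each interval lies in \<open>U\<close>, so its length is the integral of the
      indicator of \<open>U\<close> over it, and the total is at most the measure of
      \<open>U\<close>, however many intervals there are.\<close>
    have "(\<Sum>(s, r)\<in>g ` A. r - s) = (\<Sum>(s, r)\<in>g ` A. integral {s..r} (indicat_real U))"
    proof (rule sum.cong)
      fix u assume "u \<in> g ` A"
      moreover obtain s r where u: "u = (s, r)" by (cases u)
      ultimately have *: "a \<le> s \<and> s \<le> r \<and> r \<le> b \<and> {s..r} \<subseteq> U" using gA by simp
      have "integral {s..r} (indicat_real U) = integral {s..r} (\<lambda>_. 1)"
        by (rule integral_cong) (use * in auto)
      then show "(case u of (s, r) \<Rightarrow> r - s) = (case u of (s, r) \<Rightarrow> integral {s..r} (indicat_real U))"
        using * by (simp add: u)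
    qed simp
    also have "\<dots> \<le> integral {a..b} (indicat_real U)"
      by (rule sum_integral_disjoint_intervals_le[OF int_U]) (use \<open>finite A\<close> disjA gA in auto)
    also have "\<dots> \<le> measure lebesgue U"
      using U(1) by (metis integral_indicator Int_lower2 fmeasurable.Int fmeasurableD lmeasurable_interval(1) measure_mono_fmeasurable Int_commute)
    also have "\<dots> < \<delta>" by (rule U)
    finally show "(\<Sum>(s, r)\<in>g ` A. r - s) < \<delta>" .
  qed (use \<open>finite A\<close> disjA gA in auto)
  then have sumA: "(\<Sum>(x, K)\<in>A. \<bar>f (Sup K) - f (Inf K)\<bar>) < \<epsilon>"
    unfolding sum.reindex[OF inj] by (simp add: g_def case_prod_unfold)
  have "f b - f a = (\<Sum>(x, K)\<in>p. f (Sup K) - f (Inf K))"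
    using additive_tagged_division_1[OF \<open>a \<le> b\<close> p(1), of f] by simp
  moreover have "(\<Sum>(x, K)\<in>p. f (Sup K) - f (Inf K)) = (\<Sum>(x, K)\<in>A. f (Sup K) - f (Inf K)) + (\<Sum>(x, K)\<in>p - A. f (Sup K) - f (Inf K))"
    using pD(1) by (subst sum.subset_diff[of A p]) (auto simp: A_def)
  moreover have "- \<epsilon> \<le> (\<Sum>(x, K)\<in>A. f (Sup K) - f (Inf K))"
  proof -
    have "\<bar>\<Sum>(x, K)\<in>A. f (Sup K) - f (Inf K)\<bar> \<le> (\<Sum>(x, K)\<in>A. \<bar>f (Sup K) - f (Inf K)\<bar>)"
      by (rule order_trans[OF sum_abs]) (simp add: case_prod_unfold)
    with sumA show ?thesis by linarith
  qed
  moreover have "(\<Sum>(x, K)\<in>p - A. - \<epsilon> * (Sup K - Inf K)) \<le> (\<Sum>(x, K)\<in>p - A. f (Sup K) - f (Inf K))"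
  proof (rule sum_mono, clarify)
      fix x K' assume xK: "(x, K') \<in> p" "(x, K') \<notin> A"
      obtain s r where sr: "K' = {s..r}" "a \<le> s" "s \<le> x" "x \<le> r" "r \<le> b" using K[OF xK(1)] by auto
      show "- \<epsilon> * (Sup K' - Inf K') \<le> f (Sup K') - f (Inf K')"
      \<comment> \<open>An interval outside \<open>A\<close> is degenerate or tagged off
        \<open>N\<close>. In the second case the tag cuts it into two pieces, and the derivative at
        the tag controls both.\<close>
      proof (cases "s = r")
        case False
        then have x: "x \<in> {a..b} - N" using xK sr by (auto simp: A_def)
        then have "K' \<subseteq> ball x (\<rho> x)" using p(2) xK(1) by (force simp: fine_def \<gamma>_def)
        moreover have "s \<in> K'" "r \<in> K'" using sr by auto
        ultimately have "s \<in> ball x (\<rho> x)" "r \<in> ball x (\<rho> x)" by blast+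
        then have "(f s - f x) * sgn (s - x) \<ge> - \<epsilon> * \<bar>s - x\<bar>" "(f r - f x) * sgn (r - x) \<ge> - \<epsilon> * \<bar>r - x\<bar>"
          using \<rho>(2)[OF x, of s] \<rho>(2)[OF x, of r] sr by (auto simp: dist_real_def abs_minus_commute)
        then have "f x - f s \<ge> - \<epsilon> * (x - s)" "f r - f x \<ge> - \<epsilon> * (r - x)"
          using sr by (auto simp: sgn_real_def split: if_splits)
        then show ?thesis using sr by (simp add: algebra_simps)
      qed (use sr in auto)
    qed
  moreover have "(\<Sum>(x, K)\<in>p. - \<epsilon> * (Sup K - Inf K)) \<le> (\<Sum>(x, K)\<in>p - A. - \<epsilon> * (Sup K - Inf K))"
  proof -
    have "(\<Sum>(x, K)\<in>A. - \<epsilon> * (Sup K - Inf K)) \<le> 0"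
      using \<open>\<epsilon> > 0\<close> by (intro sum_nonpos) (auto simp: A_def)
    moreover have "(\<Sum>(x, K)\<in>p. - \<epsilon> * (Sup K - Inf K))
        = (\<Sum>(x, K)\<in>p - A. - \<epsilon> * (Sup K - Inf K)) + (\<Sum>(x, K)\<in>A. - \<epsilon> * (Sup K - Inf K))"
      using pD(1) by (intro sum.subset_diff) (auto simp: A_def)
    ultimately show ?thesis by linarith
  qed
  moreover have "(\<Sum>(x, K)\<in>p. - \<epsilon> * (Sup K - Inf K)) = - \<epsilon> * (b - a)"
    using additive_tagged_division_1[OF \<open>a \<le> b\<close> p(1), of "\<lambda>x. x"]
    by (simp add: case_prod_unfold sum_negf flip: sum_distrib_left)
  moreover have "\<epsilon> + \<epsilon> * (b - a) = e"
  proof -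
    have "\<epsilon> * (b - a + 1) = e" using \<open>a \<le> b\<close> by (simp add: \<epsilon>_def)
    then show ?thesis by (simp add: algebra_simps)
  qed
  ultimately show "f a \<le> f b + e" by linarith
qed

section \<open>Linear differential inequalities\<close>

text \<open>With M the indefinite integral of \<open>m\<close>, the product of f and exp(-M) is
  absolutely continuous and has a nonnegative derivative off a null set, so it is nondecreasing. The
  left end is estimated by the right end because information has to travel back from T.\<close>

lemma abs_continuous_on_differential_inequality:
  fixes f m :: "real \<Rightarrow> real"
  assumes f: "abs_continuous_on_interval a b f" and "a \<le> b"
    and m: "m absolutely_integrable_on {a..b}" and N: "negligible N"
    and deriv: "\<And>x. x \<in> {a..b} - N \<Longrightarrow> \<exists>d\<ge>m x * f x. (f has_vector_derivative d) (at x within {a..b})"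
  shows "f a \<le> f b * exp (- integral {a..b} m)"
proof -
  define M where "M t = integral {a..t} m" for t
  have M: "abs_continuous_on_interval a b M"
    unfolding M_def using m by (rule abs_continuous_on_indefinite_integral)
  \<comment> \<open>The differentiation lemma works on the half-line and wants integrability on
    every \<open>{a..c}\<close>, hence the extension by zero beyond \<open>b\<close>.\<close>
  define m' where "m' x = (if x \<le> b then m x else 0)" for x
  have m': "m' integrable_on {a..c}" for c
  proof -
    have "(\<lambda>x. if x \<in> {a..b} then m x else 0) integrable_on {a..c}"
    proof (rule integrable_on_subinterval)
      show "(\<lambda>x. if x \<in> {a..b} then m x else 0) integrable_on UNIV"
        using m integrable_restrict_UNIV[of "{a..b}" m] by (simp add: absolutely_integrable_on_def)
    qed simp
    then show ?thesis by (rule integrable_eq) (auto simp: m'_def)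
  qed
  obtain N' where N': "negligible N'" and dM': "\<And>x. a \<le> x \<Longrightarrow> x \<notin> N' \<Longrightarrow>
      ((\<lambda>t. integral {a..t} m') has_vector_derivative m' x) (at x within {a..})"
    using indefinite_integral_has_vector_derivative_ae[OF m'] by blast
  have dM: "(M has_vector_derivative m x) (at x within {a..b})" if "x \<in> {a..b}" "x \<notin> N'" for x
  proof (rule has_vector_derivative_transform[OF that(1)])
    show "M y = integral {a..y} m'" if "y \<in> {a..b}" for y
      unfolding M_def by (rule integral_cong) (use that in \<open>auto simp: m'_def\<close>)
    show "((\<lambda>t. integral {a..t} m') has_vector_derivative m x) (at x within {a..b})"
      using has_vector_derivative_within_subset[OF dM', of x "{a..b}"] that by (auto simp: m'_def)
  qed
  have "bounded (M ` {a..b})"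
    using M by (intro compact_imp_bounded compact_continuous_image abs_continuous_imp_continuous_on) auto
  then obtain K where K: "\<bar>M t\<bar> \<le> K" if "t \<in> {a..b}" for t
    unfolding bounded_iff by fastforce
  define E where "E t = exp (- M t)" for t
  \<comment> \<open>On [-K, K] the exponential has Lipschitz constant \<open>exp K\<close>; the
    auxiliary inequality \<open>*\<close> is its tangent bound 1 + x \<le> exp x at x = v -
    u.\<close>
  have E: "abs_continuous_on_interval a b E"
  proof (rule abs_continuous_on_dominated[OF M M, where K="exp K"])
    fix s r assume "a \<le> s" "s \<le> r" "r \<le> b"
    then have Kb: "exp (- M r) \<le> exp K" "exp (- M s) \<le> exp K"
      using K[of r] K[of s] by auto
    have *: "exp u - exp v \<le> exp u * (u - v)" for u v :: real
    proof -
      have "exp u * (1 + (v - u)) \<le> exp u * exp (v - u)"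
        by (intro mult_left_mono exp_ge_add_one_self) auto
      then show ?thesis by (simp add: algebra_simps flip: exp_add)
    qed
    have "E r - E s \<le> exp (- M r) * \<bar>M r - M s\<bar>"
      using *[of "- M r" "- M s"] unfolding E_def
      by (rule order_trans) (intro mult_left_mono, auto)
    moreover have "E s - E r \<le> exp (- M s) * \<bar>M r - M s\<bar>"
      using *[of "- M s" "- M r"] unfolding E_def
      by (rule order_trans) (intro mult_left_mono, auto)
    moreover have "exp (- M r) * \<bar>M r - M s\<bar> \<le> exp K * \<bar>M r - M s\<bar>"
      "exp (- M s) * \<bar>M r - M s\<bar> \<le> exp K * \<bar>M r - M s\<bar>"
      using Kb by (auto intro: mult_right_mono)
    ultimately have "\<bar>E r - E s\<bar> \<le> exp K * \<bar>M r - M s\<bar>" by linarith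
    moreover have "exp K * \<bar>M r - M s\<bar> \<ge> 0" by simp
    ultimately show "norm (E r - E s) \<le> exp K * (norm (M r - M s) + norm (M r - M s))"
      unfolding real_norm_def distrib_left by linarith
  qed
  have "f a * E a \<le> f b * E b"
  proof (rule abs_continuous_on_nonneg_derivative_imp_le[where f="\<lambda>t. f t * E t"])
    show "abs_continuous_on_interval a b (\<lambda>t. f t * E t)"
      by (rule abs_continuous_on_bilinear[OF bounded_bilinear_mult f E])
    show "negligible (N \<union> N')" using N N' by simp
  next
    fix x assume x: "x \<in> {a..b} - (N \<union> N')"
    then obtain d where d: "d \<ge> m x * f x" "(f has_vector_derivative d) (at x within {a..b})"
      using deriv[of x] by auto
    have dE: "(E has_vector_derivative (- m x * E x)) (at x within {a..b})"
      using dM[of x] x unfolding E_def has_real_derivative_iff_has_vector_derivative[symmetric]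
      by (auto intro!: derivative_eq_intros)
    have "((\<lambda>t. f t * E t) has_vector_derivative (d - m x * f x) * E x) (at x within {a..b})"
      using d(2) dE unfolding has_real_derivative_iff_has_vector_derivative[symmetric]
      by (auto intro!: derivative_eq_intros simp: algebra_simps)
    moreover have "0 \<le> (d - m x * f x) * E x" using d(1) by (simp add: E_def)
    ultimately show "\<exists>d\<ge>0. ((\<lambda>t. f t * E t) has_vector_derivative d) (at x within {a..b})"
      by blast
  qed fact
  then show ?thesis by (simp add: E_def M_def)
qed

text \<open>The inequality is asked for only where f is negative, the case in which
  \<open>\<mu>0\<close> is the right majorant. If f b < 0, then f is negative after the last time r
  with f r \<ge> 0, and the previous lemma on \<open>{r..b}\<close> would make f r negative as
  well.\<close>

lemma abs_continuous_on_differential_inequality_nonneg: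
  fixes f m :: "real \<Rightarrow> real"
  assumes f: "abs_continuous_on_interval a b f" and "a \<le> b" and "0 \<le> f a"
    and m: "m absolutely_integrable_on {a..b}" and N: "negligible N"
    and deriv: "\<And>x. x \<in> {a..b} - N \<Longrightarrow>
      \<exists>d. (f has_vector_derivative d) (at x within {a..b}) \<and> (f x < 0 \<longrightarrow> m x * f x \<le> d)"
  shows "0 \<le> f b"
proof (rule ccontr)
  assume "\<not> 0 \<le> f b"
  define S where "S = {t \<in> {a..b}. 0 \<le> f t}"
  have "closed S"
    unfolding S_def using abs_continuous_imp_continuous_on[OF f]
    by (intro continuous_closed_preimage_constant continuous_on_closed_Collect_le continuous_intros) auto
  then have "compact S"
    by (metis (no_types, lifting) S_def bounded_closed_interval bounded_subset compact_eq_bounded_closed mem_Collect_eq subsetI)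
  moreover have "a \<in> S" using \<open>a \<le> b\<close> \<open>0 \<le> f a\<close> by (simp add: S_def)
  ultimately obtain r where r: "r \<in> S" "\<And>t. t \<in> S \<Longrightarrow> t \<le> r"
    using compact_attains_sup[of S] by auto
  have "f r \<le> f b * exp (- integral {r..b} m)"
  proof (rule abs_continuous_on_differential_inequality)
    show "abs_continuous_on_interval r b f"
      using r f by (auto simp: S_def intro: abs_continuous_on_subinterval)
    show "m absolutely_integrable_on {r..b}"
      using m r by (auto simp: S_def intro: absolutely_integrable_on_subinterval)
    \<comment> \<open>At r itself f is not negative, so no inequality is available there.\<close>
    show "negligible (insert r N)" using N by simp
    fix x assume x: "x \<in> {r..b} - insert r N"
    then have "x \<notin> S" using r(2)[of x] by auto
    then have "f x < 0" using x r(1) by (auto simp: S_def)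
    moreover obtain d where d: "(f has_vector_derivative d) (at x within {a..b})" "f x < 0 \<longrightarrow> m x * f x \<le> d"
      using deriv[of x] x r(1) by (auto simp: S_def)
    moreover have "(f has_vector_derivative d) (at x within {r..b})"
      using d(1) by (rule has_vector_derivative_within_subset) (use r(1) in \<open>auto simp: S_def\<close>)
    ultimately show "\<exists>d\<ge>m x * f x. (f has_vector_derivative d) (at x within {r..b})"
      by blast
  qed (use r in \<open>auto simp: S_def\<close>)
  also have "\<dots> < 0" using \<open>\<not> 0 \<le> f b\<close> by (simp add: mult_neg_pos)
  finally show False using r by (simp add: S_def)
qed

section \<open>Complex matrices and the real inner product\<close>

text \<open>Thus w is \<open>\<phi> \<bullet> \<psi>\<close> for the real inner product, and the
  facts about bounded bilinear maps apply to it.\<close>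

lemma inner_complex_vec: "(x :: complex^'n) \<bullet> y = Re (\<Sum>i\<in>UNIV. cnj (x $ i) * y $ i)"
  by (simp add: inner_vec_def inner_complex_def)

lemma inner_ctransp: "(x :: complex^'m) \<bullet> (M *v y) = (ctransp M *v x) \<bullet> (y :: complex^'n)"
proof -
  have "(\<Sum>i\<in>UNIV. cnj (x $ i) * (\<Sum>j\<in>UNIV. M $ i $ j * y $ j))
      = (\<Sum>j\<in>UNIV. cnj (\<Sum>i\<in>UNIV. cnj (M $ i $ j) * x $ i) * y $ j)"
    unfolding sum_distrib_left cnj_sum sum_distrib_right
    by (subst sum.swap) (simp add: mult_ac)
  then show ?thesis
    unfolding inner_complex_vec by (simp add: matrix_vector_mult_def ctransp_def)
qed

lemma ctransp_ctransp: "ctransp (ctransp M) = M"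
  by (simp add: ctransp_def vec_eq_iff)

lemma bounded_bilinear_matrix_vector_mult:
  "bounded_bilinear (\<lambda>(M :: complex^'n^'m) x. M *v x)"
  unfolding bilinear_conv_bounded_bilinear[symmetric] bilinear_def
  by (auto intro!: linearI simp: matrix_vector_mult_def vec_eq_iff algebra_simps sum.distrib
      scaleR_sum_right)

lemmas matrix_vector_mult_add_right = bounded_bilinear.add_right[OF bounded_bilinear_matrix_vector_mult]
lemmas matrix_vector_mult_scaleR_right = bounded_bilinear.scaleR_right[OF bounded_bilinear_matrix_vector_mult]

lemma bounded_linear_ctransp: "bounded_linear (ctransp :: complex^'n^'m \<Rightarrow> _)"
  unfolding linear_conv_bounded_linear[symmetric]
  by (auto intro!: linearI simp: ctransp_def vec_eq_iff)

lemma nonneg_definite_inner: "nonneg_definite M \<Longrightarrow> 0 \<le> x \<bullet> (M *v x)"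
  by (simp add: nonneg_definite_def inner_complex_vec)

text \<open>A matrix and its adjoint have the same real quadratic form, so the form of
  \<open>M\<close> is half that of the sum. This serves both for C and for the matrix Y of a
  conjoined solution.\<close>

lemma nonneg_definite_add_ctransp_inner:
  assumes "nonneg_definite (M + ctransp M)"
  shows "0 \<le> x \<bullet> (M *v x)"
proof -
  have "x \<bullet> (ctransp M *v x) = x \<bullet> (M *v x)"
    using inner_ctransp[of x M x] by (simp add: inner_commute)
  then show ?thesis
    using nonneg_definite_inner[OF assms, of x]
    by (simp add: matrix_vector_mult_add_rdistrib inner_add_right)
qed

text \<open>At x the nonnegative form attains its minimum 0, so its derivative vanishes in every
  direction; in the direction \<open>M *v x\<close> that derivative is twice the squared norm of
  \<open>M *v x\<close>.\<close>

lemma nonneg_definite_inner_eq_0: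
  assumes M: "nonneg_definite M" and "x \<bullet> (M *v x) = 0"
  shows "M *v x = 0"
proof -
  define y where "y = M *v x"
  have "x \<bullet> (M *v y) = y \<bullet> y"
    using inner_ctransp[of x M y] M by (simp add: y_def nonneg_definite_def hermitian_def)
  then have nonneg: "0 \<le> 2 * e * (y \<bullet> y) + e\<^sup>2 * (y \<bullet> (M *v y))" for e
    using nonneg_definite_inner[OF M, of "x + e *\<^sub>R y"] assms(2)
    by (simp add: matrix_vector_mult_add_right matrix_vector_mult_scaleR_right inner_add_left inner_add_right algebra_simps power2_eq_square flip: y_def)
  have "y \<bullet> y = 0"
  proof (rule ccontr)
    assume "y \<bullet> y \<noteq> 0"
    then have "y \<bullet> y > 0" using inner_ge_zero[of y] by linarith
    define q where "q = y \<bullet> (M *v y)"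
    have "q \<ge> 0" unfolding q_def using M by (rule nonneg_definite_inner)
    \<comment> \<open>A small negative step makes the linear term win: here
      \<open>e * q = - (y \<bullet> y) - e\<close>, so \<open>2 * (y \<bullet> y) + e * q\<close>
      stays positive. The divisor q + 1 is nonzero even if q = 0.\<close>
    define e where "e = - (y \<bullet> y) / (q + 1)"
    have "e < 0" using \<open>y \<bullet> y > 0\<close> \<open>q \<ge> 0\<close> by (simp add: e_def)
    have "e * (q + 1) = - (y \<bullet> y)" using \<open>q \<ge> 0\<close> by (simp add: e_def)
    then have "2 * (y \<bullet> y) + e * q > 0" using \<open>y \<bullet> y > 0\<close> \<open>e < 0\<close> unfolding distrib_left by linarith
    then have "e * (2 * (y \<bullet> y) + e * q) < 0" using \<open>e < 0\<close> by (simp add: mult_neg_pos)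
    with nonneg[of e] show False by (simp add: q_def algebra_simps power2_eq_square)
  qed
  then show ?thesis by (simp add: y_def)
qed

lemma mat_of_real_mult_vector: "mat (complex_of_real c) *v x = c *\<^sub>R x"
proof -
  have "(\<Sum>j\<in>UNIV. (if i = j then complex_of_real c else 0) * x $ j) = complex_of_real c * x $ i" for i
    by (subst sum.remove[of _ i]) auto
  then show ?thesis
    by (simp add: vec_eq_iff matrix_vector_mult_def mat_def scaleR_conv_of_real[where 'a=complex])
qed

section \<open>Solutions of the system\<close>

text \<open>Stated with \<open>0 \<le> \<phi> t1 \<bullet> \<psi> t1\<close> because the matrix of a
  conjoined solution matters only through this sign.\<close>

lemma solution_from_nonzero:
  fixes A B C :: "real \<Rightarrow> complex^'n \<Rightarrow> complex^'n \<Rightarrow> complex^'n^'n"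
  assumes sol: "solution_from t0 A B C \<mu> \<phi> \<psi>"
    and "t0 \<le> t1" "\<phi> t1 \<noteq> 0" "0 \<le> \<phi> t1 \<bullet> \<psi> t1" "t1 \<le> T"
    and a0: "locally_integrable_from t0 a0" and \<mu>0: "locally_integrable_from t0 \<mu>0"
    and A: "\<And>t u v. t0 \<le> t \<Longrightarrow> norm (A t u v) \<le> a0 t"
    and \<mu>: "\<And>t u v. t0 \<le> t \<Longrightarrow> \<bar>\<mu> t u v\<bar> \<le> \<mu>0 t"
    and B: "\<And>t u v. t0 \<le> t \<Longrightarrow> nonneg_definite (B t u v)"
    and C: "\<And>t u v. t0 \<le> t \<Longrightarrow> nonneg_definite (C t u v + ctransp (C t u v))"
  shows "\<phi> T \<noteq> 0"
proof
  assume "\<phi> T = 0"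
  \<comment> \<open>The interval must be nondegenerate for derivatives within it to be unique; this
    is used where w is known to vanish.\<close>
  with assms have "t1 < T" by (cases "t1 = T") auto
  define A' B' C' c where "A' t = A t (\<phi> t) (\<psi> t)" and "B' t = B t (\<phi> t) (\<psi> t)"
    and "C' t = C t (\<phi> t) (\<psi> t)" and "c t = \<mu> t (\<phi> t) (\<psi> t)" for t
  obtain N where N: "negligible N" and deriv0: "\<And>t. t \<notin> N \<Longrightarrow> t0 \<le> t \<Longrightarrow>
      (\<phi> has_vector_derivative (A' t *v \<phi> t + B' t *v \<psi> t)) (at t within {t0..}) \<and>
      (\<psi> has_vector_derivative (C' t *v \<phi> t + (mat (complex_of_real (c t)) - ctransp (A' t)) *v \<psi> t))
        (at t within {t0..})"
    using sol unfolding solution_from_def eventually_ae_filter_negligible A'_def B'_def C'_def c_def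
    by blast
  have d\<phi>: "(\<phi> has_vector_derivative (A' t *v \<phi> t + B' t *v \<psi> t)) (at t within {t1..T})"
    and d\<psi>: "(\<psi> has_vector_derivative (C' t *v \<phi> t + (mat (complex_of_real (c t)) - ctransp (A' t)) *v \<psi> t))
        (at t within {t1..T})" if "t \<in> {t1..T} - N" for t
    using deriv0[of t] that \<open>t0 \<le> t1\<close> by (auto intro: has_vector_derivative_within_subset)
  have ac: "abs_continuous_on_interval t1 T \<phi>" "abs_continuous_on_interval t1 T \<psi>"
    using sol \<open>t0 \<le> t1\<close> \<open>t1 \<le> T\<close> by (auto simp: solution_from_def locally_abs_continuous_from_def)
  have int: "m absolutely_integrable_on {s..r}"
    if "locally_integrable_from t0 m" "t0 \<le> s" "s \<le> r" for m :: "real \<Rightarrow> real" and s r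
    using that unfolding locally_integrable_from_def
    by (meson absolutely_integrable_on_subinterval atLeastatMost_subset_iff order_refl order_trans)
  define w where "w t = \<phi> t \<bullet> \<psi> t" for t
  define p where "p t = \<psi> t \<bullet> (B' t *v \<psi> t) + \<phi> t \<bullet> (C' t *v \<phi> t)" for t
  have Bpos: "0 \<le> \<psi> t \<bullet> (B' t *v \<psi> t)" and Cpos: "0 \<le> \<phi> t \<bullet> (C' t *v \<phi> t)" if "t1 \<le> t" for t
    using that \<open>t0 \<le> t1\<close> unfolding B'_def C'_def
    by (intro nonneg_definite_inner nonneg_definite_add_ctransp_inner B C; simp)+
  have acw: "abs_continuous_on_interval t1 T w"
    unfolding w_def by (rule abs_continuous_on_bilinear[OF bounded_bilinear_inner ac])
  \<comment> \<open>The terms with \<open>A\<close> cancel.\<close>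
  have dw: "(w has_vector_derivative (p t + c t * w t)) (at t within {t1..T})" if "t \<in> {t1..T} - N" for t
  proof -
    have "\<phi> t \<bullet> (ctransp (A' t) *v \<psi> t) = (A' t *v \<phi> t) \<bullet> \<psi> t"
      using inner_ctransp[of "\<phi> t" "ctransp (A' t)" "\<psi> t"] by (simp add: ctransp_ctransp)
    then have "\<phi> t \<bullet> (C' t *v \<phi> t + (mat (complex_of_real (c t)) - ctransp (A' t)) *v \<psi> t)
        + (A' t *v \<phi> t + B' t *v \<psi> t) \<bullet> \<psi> t = p t + c t * w t"
      by (simp add: p_def w_def matrix_vector_mult_diff_rdistrib mat_of_real_mult_vector
          inner_add_left inner_add_right inner_diff_right inner_commute)
    then show ?thesis
      using bounded_bilinear.has_vector_derivative[OF bounded_bilinear_inner d\<phi>[OF that] d\<psi>[OF that]]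
      by (simp add: w_def[abs_def])
  qed
  have cb: "\<bar>c t\<bar> \<le> \<mu>0 t" if "t1 \<le> t" for t
    using \<mu>[of t] that \<open>t0 \<le> t1\<close> by (simp add: c_def)
  have w_nonneg: "0 \<le> w s" if s: "s \<in> {t1..T}" for s
  proof (rule abs_continuous_on_differential_inequality_nonneg[where f=w and a=t1])
    show "abs_continuous_on_interval t1 s w"
      using acw s by (auto intro: abs_continuous_on_subinterval)
    show "\<mu>0 absolutely_integrable_on {t1..s}" using s \<open>t0 \<le> t1\<close> by (intro int \<mu>0) auto
    fix t assume t: "t \<in> {t1..s} - N"
    have "(w has_vector_derivative (p t + c t * w t)) (at t within {t1..s})"
      by (rule has_vector_derivative_within_subset[OF dw]) (use t s in auto)
    moreover have "\<mu>0 t * w t \<le> p t + c t * w t" if "w t < 0"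
    proof -
      have "\<mu>0 t * w t \<le> c t * w t"
        using cb[of t] t that by (intro mult_right_mono_neg) auto
      then show ?thesis using Bpos[of t] Cpos[of t] t by (simp add: p_def)
    qed
    ultimately show "\<exists>d. (w has_vector_derivative d) (at t within {t1..s}) \<and> (w t < 0 \<longrightarrow> \<mu>0 t * w t \<le> d)"
      by blast
  qed (use s assms(4) N in \<open>auto simp: w_def\<close>)
  \<comment> \<open>Now that w \<ge> 0, the coefficient \<open>- \<mu>0\<close> is admissible, and w
    T = 0 bounds w s from above by 0.\<close>
  have w_zero: "w s = 0" if s: "s \<in> {t1..T}" for s
  proof -
    have "w s \<le> w T * exp (- integral {s..T} (\<lambda>t. - \<mu>0 t))"
    proof (rule abs_continuous_on_differential_inequality)
      show "abs_continuous_on_interval s T w"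
        using acw s by (auto intro: abs_continuous_on_subinterval)
      show "(\<lambda>t. - \<mu>0 t) absolutely_integrable_on {s..T}"
        using set_integrable_mult_right[OF int[OF \<mu>0, of s T], of "-1"] s \<open>t0 \<le> t1\<close> by simp
      fix t assume t: "t \<in> {s..T} - N"
      have "(w has_vector_derivative (p t + c t * w t)) (at t within {s..T})"
        by (rule has_vector_derivative_within_subset[OF dw]) (use t s in auto)
      moreover have "- \<mu>0 t * w t \<le> p t + c t * w t"
      proof -
        have "- \<mu>0 t * w t \<le> c t * w t"
          using cb[of t] t s w_nonneg[of t] by (intro mult_right_mono) auto
        then show ?thesis using Bpos[of t] Cpos[of t] t s by (simp add: p_def)
      qed
      ultimately show "\<exists>d\<ge>- \<mu>0 t * w t. (w has_vector_derivative d) (at t within {s..T})"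
        by blast
    qed (use s N in auto)
    also have "w T = 0" using \<open>\<phi> T = 0\<close> by (simp add: w_def)
    finally show ?thesis using w_nonneg[OF s] by simp
  qed
  have B0: "B' t *v \<psi> t = 0" if t: "t \<in> {t1..T} - N" for t
  proof -
    have "(w has_vector_derivative 0) (at t within {t1..T})"
      by (rule has_vector_derivative_transform[of _ _ _ "\<lambda>_. 0"]) (use w_zero t in auto)
    then have "p t + c t * w t = 0"
      using vector_derivative_unique_within_closed_interval[OF \<open>t1 < T\<close>, of t w] dw[OF t] t by auto
    then have "p t = 0" using w_zero[of t] t by simp
    then have "\<psi> t \<bullet> (B' t *v \<psi> t) = 0"
      using Bpos[of t] Cpos[of t] t by (simp add: p_def)
    then show ?thesis
      using B[of t] t \<open>t0 \<le> t1\<close> by (intro nonneg_definite_inner_eq_0) (auto simp: B'_def)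
  qed
  obtain K where "K > 0" and K: "\<And>(M :: complex^'n^'n) x. norm (M *v x) \<le> norm M * norm x * K"
    using bounded_bilinear.pos_bounded[OF bounded_bilinear_matrix_vector_mult] by blast
  \<comment> \<open>Gronwall for the squared norm, read backward. The 2 comes from differentiating a
    square, and \<open>K\<close> compares the norm of \<open>M *v x\<close> with the product of the
    norms of M and x.\<close>
  have "\<phi> t1 \<bullet> \<phi> t1 \<le> \<phi> T \<bullet> \<phi> T * exp (- integral {t1..T} (\<lambda>t. (- 2 * K) * a0 t))"
  proof (rule abs_continuous_on_differential_inequality[where f="\<lambda>t. \<phi> t \<bullet> \<phi> t"])
    show "abs_continuous_on_interval t1 T (\<lambda>t. \<phi> t \<bullet> \<phi> t)"
      by (rule abs_continuous_on_bilinear[OF bounded_bilinear_inner ac(1) ac(1)])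
    show "(\<lambda>t. (- 2 * K) * a0 t) absolutely_integrable_on {t1..T}"
      using int[OF a0 \<open>t0 \<le> t1\<close> \<open>t1 \<le> T\<close>] by (rule set_integrable_mult_right)
    fix t assume t: "t \<in> {t1..T} - N"
    have "((\<lambda>t. \<phi> t \<bullet> \<phi> t) has_vector_derivative 2 * (\<phi> t \<bullet> (A' t *v \<phi> t))) (at t within {t1..T})"
      using bounded_bilinear.has_vector_derivative[OF bounded_bilinear_inner d\<phi>[OF t] d\<phi>[OF t]] B0[OF t]
      by (simp add: inner_commute)
    moreover have "- 2 * K * a0 t * (\<phi> t \<bullet> \<phi> t) \<le> 2 * (\<phi> t \<bullet> (A' t *v \<phi> t))"
    proof -
      have "\<bar>\<phi> t \<bullet> (A' t *v \<phi> t)\<bar> \<le> norm (\<phi> t) * (norm (A' t) * norm (\<phi> t) * K)"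
        by (rule order_trans[OF Cauchy_Schwarz_ineq2]) (intro mult_left_mono K, simp)
      also have "\<dots> \<le> norm (\<phi> t) * (a0 t * norm (\<phi> t) * K)"
        using \<open>K > 0\<close> A[of t] t \<open>t0 \<le> t1\<close> by (intro mult_left_mono mult_right_mono) (auto simp: A'_def)
      also have "\<dots> = K * a0 t * (\<phi> t \<bullet> \<phi> t)"
        by (simp add: dot_square_norm power2_eq_square)
      finally show ?thesis by linarith
    qed
    ultimately show "\<exists>d\<ge>- 2 * K * a0 t * (\<phi> t \<bullet> \<phi> t). ((\<lambda>t. \<phi> t \<bullet> \<phi> t) has_vector_derivative d) (at t within {t1..T})"
      by blast
  qed fact+
  then have "\<phi> t1 \<bullet> \<phi> t1 \<le> 0" using \<open>\<phi> T = 0\<close> by simp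
  with \<open>\<phi> t1 \<noteq> 0\<close> show False by (metis inner_gt_zero_iff not_le)
qed

section \<open>Global existence\<close>

text \<open>Euler polygons are used because they freeze the state on each step, so that
  \<open>t \<mapsto> G t (z t)\<close> is integrable for them without any Caratheodory measurability theorem; for the
  limit, integrability then comes from dominated convergence.\<close>

lemma euler_polygon:
  fixes G :: "real \<Rightarrow> 'a::euclidean_space \<Rightarrow> 'a"
  assumes int: "\<And>x T. t0 \<le> T \<Longrightarrow> (\<lambda>t. G t x) absolutely_integrable_on {t0..T}"
    and m: "\<And>T. t0 \<le> T \<Longrightarrow> m integrable_on {t0..T}" "\<And>t. t0 \<le> t \<Longrightarrow> 0 \<le> m t"
    and bound: "\<And>t x. t0 \<le> t \<Longrightarrow> norm (G t x) \<le> m t * norm x"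
    and "0 < h"
  obtains z where "\<And>T. t0 \<le> T \<Longrightarrow> (\<lambda>t. G t (z t)) absolutely_integrable_on {t0..T}"
    "\<And>t. t0 \<le> t \<Longrightarrow> \<exists>s\<in>{t0..t}. t - h \<le> s \<and> z t = x0 + integral {t0..s} (\<lambda>t. G t (z t))"
    "\<And>t. t0 \<le> t \<Longrightarrow> norm (z t) \<le> norm x0 * exp (integral {t0..t} m)"
proof -
  define \<tau> where "\<tau> j = t0 + real j * h" for j
  define y where "y = rec_nat x0 (\<lambda>j v. v + integral {\<tau> j..\<tau> (Suc j)} (\<lambda>s. G s v))"
  \<comment> \<open>A step function: on each grid interval it keeps the value \<open>y j\<close>
    that the polygon has at the left end. So z t is the polygon at the last grid point up to t, less
    than h earlier.\<close>
  define z where "z s = y (nat \<lfloor>(s - t0) / h\<rfloor>)" for s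
  define F where "F t = G t (z t)" for t
  have y: "y 0 = x0" "y (Suc j) = y j + integral {\<tau> j..\<tau> (Suc j)} (\<lambda>s. G s (y j))" for j
    by (simp_all add: y_def)
  have \<tau>: "t0 \<le> \<tau> j" "\<tau> j \<le> \<tau> (Suc j)" "\<tau> 0 = t0" "\<tau> (Suc j) = \<tau> j + h" for j
    using \<open>0 < h\<close> by (simp_all add: \<tau>_def algebra_simps)
  have z: "z s = y j" if "\<tau> j \<le> s" "s < \<tau> (Suc j)" for s j
  proof -
    have "real j \<le> (s - t0) / h" "(s - t0) / h < real j + 1"
      using that \<open>0 < h\<close> by (simp_all add: \<tau>_def field_simps)
    then have "\<lfloor>(s - t0) / h\<rfloor> = int j" by (intro floor_unique) auto
    then show ?thesis by (simp add: z_def)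
  qed
  have Gj: "(\<lambda>s. G s v) absolutely_integrable_on {\<tau> j..\<tau> (Suc j)}" for j v
    by (rule absolutely_integrable_on_subinterval[OF int[OF \<tau>(1)[of "Suc j"]]]) (use \<tau>(1)[of j] in auto)
  have Fj: "F absolutely_integrable_on {\<tau> j..\<tau> (Suc j)}"
      "integral {\<tau> j..\<tau> (Suc j)} F = integral {\<tau> j..\<tau> (Suc j)} (\<lambda>s. G s (y j))" for j
  proof -
    \<comment> \<open>The right end is spared because the step function already has its next value
      there.\<close>
    have eq: "F s = G s (y j)" if "s \<in> {\<tau> j..\<tau> (Suc j)} - {\<tau> (Suc j)}" for s
      using that by (auto simp: F_def z[of j])
    show "F absolutely_integrable_on {\<tau> j..\<tau> (Suc j)}"
      by (rule absolutely_integrable_spike[OF Gj[of j "y j"] negligible_sing eq])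
    show "integral {\<tau> j..\<tau> (Suc j)} F = integral {\<tau> j..\<tau> (Suc j)} (\<lambda>s. G s (y j))"
      by (rule integral_spike[OF negligible_sing[of "\<tau> (Suc j)"]]) (rule eq[symmetric])
  qed
  have F: "F absolutely_integrable_on {t0..\<tau> j} \<and> y j = x0 + integral {t0..\<tau> j} F" for j
  proof (induction j)
    case 0
    show ?case by (simp add: \<tau> y absolutely_integrable_negligible)
  next
    case (Suc j)
    have abs: "F absolutely_integrable_on {t0..\<tau> (Suc j)}"
      using absolutely_integrable_on_combine[where f=F and a=t0 and c="\<tau> j" and b="\<tau> (Suc j)"] Suc Fj(1) \<tau> by blast
    have "integral {t0..\<tau> (Suc j)} F = integral {t0..\<tau> j} F + integral {\<tau> j..\<tau> (Suc j)} F"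
      using Henstock_Kurzweil_Integration.integral_combine[of t0 "\<tau> j" "\<tau> (Suc j)" F] abs \<tau>
      by (simp add: absolutely_integrable_on_def)
    with abs Suc show ?case by (simp add: y Fj)
  qed
  have ex: "\<exists>j. \<tau> j \<le> t \<and> t < \<tau> (Suc j)" if "t0 \<le> t" for t
  proof -
    have "0 \<le> (t - t0) / h" using that \<open>0 < h\<close> by simp
    then have "real (nat \<lfloor>(t - t0) / h\<rfloor>) \<le> (t - t0) / h" "(t - t0) / h < real (nat \<lfloor>(t - t0) / h\<rfloor>) + 1"
      by linarith+
    then show ?thesis
      using \<open>0 < h\<close> by (intro exI[of _ "nat \<lfloor>(t - t0) / h\<rfloor>"]) (simp add: \<tau>_def field_simps)
  qed
  have m': "m integrable_on {a..b}" if "t0 \<le> a" for a b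
    using that by (cases "a \<le> b") (auto intro: integrable_on_subinterval[OF m(1)[of b]])
  have y_bound: "norm (y j) \<le> norm x0 * exp (integral {t0..\<tau> j} m)" for j
  proof (induction j)
    case 0
    show ?case by (simp add: \<tau> y)
  next
    case (Suc j)
    have "norm (integral {\<tau> j..\<tau> (Suc j)} (\<lambda>s. G s (y j))) \<le> integral {\<tau> j..\<tau> (Suc j)} (\<lambda>s. m s * norm (y j))"
    proof (rule integral_norm_bound_integral)
      show "(\<lambda>s. m s * norm (y j)) integrable_on {\<tau> j..\<tau> (Suc j)}"
        by (intro integrable_on_mult_left m' \<tau>)
      show "norm (G x (y j)) \<le> m x * norm (y j)" if "x \<in> {\<tau> j..\<tau> (Suc j)}" for x
        using that \<tau>(1)[of j] by (intro bound) auto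
    qed (use Gj in \<open>auto simp: absolutely_integrable_on_def\<close>)
    then have "norm (y (Suc j)) \<le> norm (y j) * (1 + integral {\<tau> j..\<tau> (Suc j)} m)"
      unfolding y(2) by (intro order_trans[OF norm_triangle_ineq]) (simp add: algebra_simps)
    \<comment> \<open>Discrete Gronwall: 1 + x \<le> exp x turns the recursion into a product of
      exponentials, and the resulting bound does not depend on h.\<close>
    also have "\<dots> \<le> norm (y j) * exp (integral {\<tau> j..\<tau> (Suc j)} m)"
      by (intro mult_left_mono exp_ge_add_one_self) auto
    also have "\<dots> \<le> norm x0 * exp (integral {t0..\<tau> j} m) * exp (integral {\<tau> j..\<tau> (Suc j)} m)"
      using Suc by (intro mult_right_mono) auto
    also have "\<dots> = norm x0 * exp (integral {t0..\<tau> (Suc j)} m)"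
      using Henstock_Kurzweil_Integration.integral_combine[of t0 "\<tau> j" "\<tau> (Suc j)" m] m'[of t0 "\<tau> (Suc j)"] \<tau>
      by (simp add: mult.assoc flip: exp_add)
    finally show ?case .
  qed
  show thesis
  proof
    fix t assume "t0 \<le> t"
    with ex obtain j where j: "\<tau> j \<le> t" "t < \<tau> (Suc j)" by blast
    then show "(\<lambda>t. G t (z t)) absolutely_integrable_on {t0..t}"
      using absolutely_integrable_on_subinterval[where f=F and S="{t0..\<tau> (Suc j)}" and a=t0 and b=t] F[of "Suc j"]
      by (simp add: F_def[abs_def])
    show "\<exists>s\<in>{t0..t}. t - h \<le> s \<and> z t = x0 + integral {t0..s} (\<lambda>t. G t (z t))"
      using F[of j] j z[OF j] \<tau>(1)[of j] \<tau>(4)[of j] by (intro bexI[of _ "\<tau> j"]) (auto simp: F_def[abs_def])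
    have "norm (z t) \<le> norm x0 * exp (integral {t0..\<tau> j} m)"
      using y_bound z[OF j] by simp
    also have "\<dots> \<le> norm x0 * exp (integral {t0..t} m)"
      using j \<tau>(1)[of j] m(2)
      by (intro mult_left_mono exp_le_cancel_iff[THEN iffD2] integral_subset_le m') auto
    finally show "norm (z t) \<le> norm x0 * exp (integral {t0..t} m)" .
  qed
qed

text \<open>Linear growth bounds all polygons by \<open>R\<close> on the whole half-line, so no
  continuation argument arises. Their increments are at most \<open>R T * (M t - M s)\<close> up to
  time T, uniformly in k; hence a diagonal subsequence that converges at the rationals converges
  everywhere. Continuity of \<open>G t\<close> and dominated convergence then pass to the limit in
  the integral equation.\<close>

proposition caratheodory_existence_linear_growth:
  fixes G :: "real \<Rightarrow> 'a::euclidean_space \<Rightarrow> 'a"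
  assumes int: "\<And>x T. t0 \<le> T \<Longrightarrow> (\<lambda>t. G t x) absolutely_integrable_on {t0..T}"
    and cont: "\<And>t. t0 \<le> t \<Longrightarrow> continuous_on UNIV (G t)"
    and m: "\<And>T. t0 \<le> T \<Longrightarrow> m integrable_on {t0..T}" "\<And>t. t0 \<le> t \<Longrightarrow> 0 \<le> m t"
    and bound: "\<And>t x. t0 \<le> t \<Longrightarrow> norm (G t x) \<le> m t * norm x"
  obtains X where "\<And>T. t0 \<le> T \<Longrightarrow> (\<lambda>t. G t (X t)) absolutely_integrable_on {t0..T}"
    "\<And>t. t0 \<le> t \<Longrightarrow> X t = x0 + integral {t0..t} (\<lambda>s. G s (X s))"
proof -
  define M where "M t = integral {t0..t} m" for t
  define R where "R t = norm x0 * exp (M t)" for t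
  have m': "m integrable_on {a..b}" if "t0 \<le> a" for a b
    using that by (cases "a \<le> b") (auto intro: integrable_on_subinterval[OF m(1)[of b]])
  have M_diff: "integral {s..t} m = M t - M s" if "t0 \<le> s" "s \<le> t" for s t
    using Henstock_Kurzweil_Integration.integral_combine[OF that m'] by (simp add: M_def)
  have M_mono: "M s \<le> M t" if "t0 \<le> s" "s \<le> t" for s t
    using M_diff[OF that] Henstock_Kurzweil_Integration.integral_nonneg[OF m'[of s t]] m(2) that by fastforce
  have M_cont: "continuous_on {t0..t} M" for t
    unfolding M_def using m'[of t0 t] by (intro indefinite_integral_continuous_1) auto
  have R_mono: "R s \<le> R t" if "t0 \<le> s" "s \<le> t" for s t
    using M_mono[OF that] by (simp add: R_def mult_left_mono)
  have R_nonneg: "0 \<le> R t" for t by (simp add: R_def)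
  define polygon where "polygon k z \<longleftrightarrow> (\<forall>T\<ge>t0. (\<lambda>t. G t (z t)) absolutely_integrable_on {t0..T}) \<and>
      (\<forall>t\<ge>t0. \<exists>s\<in>{t0..t}. t - inverse (real (Suc k)) \<le> s \<and> z t = x0 + integral {t0..s} (\<lambda>t. G t (z t))) \<and>
      (\<forall>t\<ge>t0. norm (z t) \<le> R t)" for k z
  have "\<exists>z. polygon k z" for k
    unfolding polygon_def R_def M_def
    by (rule euler_polygon[OF int m bound, where h="inverse (real (Suc k))" and ?x0.0=x0]) auto
  then obtain z where z: "\<And>k. polygon k (z k)" by metis
  have z_int: "(\<lambda>t. G t (z k t)) absolutely_integrable_on {t0..T}" if "t0 \<le> T" for k T
    using z[of k] that unfolding polygon_def by blast
  have z_eq: "\<exists>s\<in>{t0..t}. t - inverse (real (Suc k)) \<le> s \<and> z k t = x0 + integral {t0..s} (\<lambda>t. G t (z k t))"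
    if "t0 \<le> t" for k t
    using z[of k] that unfolding polygon_def by blast
  have z_bound: "norm (z k t) \<le> R t" if "t0 \<le> t" for k t
    using z[of k] that unfolding polygon_def by blast
  define F where "F k t = G t (z k t)" for k t
  \<comment> \<open>\<open>Y k\<close> is the continuous polygon and \<open>z k\<close> its step
    version: \<open>z k t = Y k s\<close> for some s at most 1/(k+1) before t. Equicontinuity holds
    for \<open>Y\<close>, whereas \<open>G\<close> is evaluated along \<open>z\<close>.\<close>
  define Y where "Y k t = x0 + integral {t0..t} (F k)" for k t
  have F_int: "F k absolutely_integrable_on {t0..T}" if "t0 \<le> T" for k T
    using z_int[OF that] by (simp add: F_def[abs_def])
  have F_bound: "norm (F k s) \<le> m s * R T" if "s \<in> {t0..T}" for k s T
  proof -
    have "norm (F k s) \<le> m s * norm (z k s)" using that by (simp add: F_def bound)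
    also have "\<dots> \<le> m s * R T"
      using that m(2) z_bound[of s k] R_mono[of s T] by (intro mult_left_mono) auto
    finally show ?thesis .
  qed
  have Y_diff: "norm (Y k t - Y k s) \<le> R T * (M t - M s)" if "t0 \<le> s" "s \<le> t" "t \<le> T" for k s t T
  proof -
    have Fst: "F k integrable_on {s..t}" "F k integrable_on {t0..t}"
      using F_int[of t k] that
      by (auto simp: absolutely_integrable_on_def intro: integrable_on_subinterval)
    have "Y k t - Y k s = integral {s..t} (F k)"
      using Henstock_Kurzweil_Integration.integral_combine[OF that(1,2) Fst(2)]
      by (simp add: Y_def algebra_simps)
    also have "norm \<dots> \<le> integral {s..t} (\<lambda>x. m x * R T)"
      using Fst(1) that by (intro integral_norm_bound_integral integrable_on_mult_left m' F_bound) auto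
    also have "\<dots> = R T * (M t - M s)" using that by (simp add: M_diff)
    finally show ?thesis .
  qed
  \<comment> \<open>The selection theorem wants one bound for all points, hence the later division
    by this pointwise bound; the 1 keeps it positive.\<close>
  define Q where "Q t = norm x0 + R t * M t + 1" for t
  have Q: "norm (Y k t) \<le> Q t" "0 < Q t" if "t0 \<le> t" for k t
  proof -
    have Yt0: "Y k t0 = x0" "M t0 = 0" by (simp_all add: Y_def M_def)
    show "norm (Y k t) \<le> Q t"
      using Y_diff[of t0 t t k] that norm_triangle_sub[of "Y k t" x0] by (simp add: Yt0 Q_def)
    have "0 \<le> R t * M t" using M_mono[of t0 t] that R_nonneg Yt0 by (intro mult_nonneg_nonneg) auto
    then show "0 < Q t" unfolding Q_def using norm_ge_zero[of x0] by linarith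
  qed
  obtain \<sigma> :: "nat \<Rightarrow> nat" where "strict_mono \<sigma>"
    and \<sigma>: "\<And>q. q \<in> \<rat> \<inter> {t0..} \<Longrightarrow> \<exists>l. (\<lambda>n. Y (\<sigma> n) q /\<^sub>R Q q) \<longlonglongrightarrow> l"
  proof (rule function_convergent_subsequence[of "\<rat> \<inter> {t0..}" "\<lambda>k q. Y k q /\<^sub>R Q q" 1])
    show "countable (\<rat> \<inter> {t0..})" by (intro countable_Int1 countable_rat)
    show "norm (Y k q /\<^sub>R Q q) \<le> 1" if "q \<in> \<rat> \<inter> {t0..}" for k q
      using Q(1)[of q k] Q(2)[of q] that by (simp add: field_simps)
  qed blast
  have conv: "Cauchy (\<lambda>n. Y (\<sigma> n) q)" if q: "q \<in> \<rat>" "t0 \<le> q" for q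
  proof -
    obtain l where "(\<lambda>n. Y (\<sigma> n) q /\<^sub>R Q q) \<longlonglongrightarrow> l" using \<sigma>[of q] q by auto
    then have "(\<lambda>n. Q q *\<^sub>R (Y (\<sigma> n) q /\<^sub>R Q q)) \<longlonglongrightarrow> Q q *\<^sub>R l" by (intro tendsto_intros)
    then have "(\<lambda>n. Y (\<sigma> n) q) \<longlonglongrightarrow> Q q *\<^sub>R l" using Q(2)[OF q(2)] by simp
    then show ?thesis by (rule LIMSEQ_imp_Cauchy)
  qed
  have "convergent (\<lambda>n. Y (\<sigma> n) t)" if "t0 \<le> t" for t
    unfolding Cauchy_convergent_iff[symmetric]
  proof (rule metric_CauchyI)
    fix e :: real assume "e > 0"
    \<comment> \<open>The rational point below will lie between t and t + 1, where
      \<open>R (t + 1)\<close> controls the increments; the added 1 makes r a legitimate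
      divisor.\<close>
    define r where "r = R (t + 1) + 1"
    have "r > 0" using R_nonneg[of "t + 1"] by (simp add: r_def)
    then have "0 < e / (3 * r)" using \<open>e > 0\<close> by simp
    moreover have "t \<in> {t0..t + 1}" using that by simp
    ultimately have "\<exists>d>0. \<forall>y\<in>{t0..t + 1}. dist y t < d \<longrightarrow> dist (M y) (M t) < e / (3 * r)"
      using M_cont[of "t + 1", unfolded continuous_on_iff] by blast
    then obtain d where "d > 0" and d: "\<And>y. y \<in> {t0..t + 1} \<Longrightarrow> dist y t < d \<Longrightarrow> dist (M y) (M t) < e / (3 * r)"
      by blast
    \<comment> \<open>The rational lies to the right of t because t may be
      \<open>t0\<close>.\<close>
    obtain q where q: "q \<in> \<rat>" "t < q" "q < t + min d 1"
      using Rats_dense_in_real[of t "t + min d 1"] \<open>d > 0\<close> by auto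
    have "M q - M t < e / (3 * r)"
    proof -
      have "q < t + d" "q < t + 1" using q(3) by simp_all
      then have "\<bar>M q - M t\<bar> < e / (3 * r)"
        using d[of q] q(2) that by (simp add: dist_real_def)
      then show ?thesis by linarith
    qed
    then have "r * (M q - M t) < e / 3" using \<open>r > 0\<close> by (simp add: field_simps)
    moreover have "R (t + 1) * (M q - M t) \<le> r * (M q - M t)"
      using M_mono[of t q] that q by (intro mult_right_mono) (auto simp: r_def)
    ultimately have close: "norm (Y k q - Y k t) < e / 3" for k
      using Y_diff[of t q "t + 1" k] that q by fastforce
    have "t0 \<le> q" using that q by linarith
    obtain n0 where n0: "\<And>i j. i \<ge> n0 \<Longrightarrow> j \<ge> n0 \<Longrightarrow> dist (Y (\<sigma> i) q) (Y (\<sigma> j) q) < e / 3"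
      using metric_CauchyD[OF conv[OF q(1) \<open>t0 \<le> q\<close>], of "e / 3"] \<open>e > 0\<close> by auto
    show "\<exists>n0. \<forall>i\<ge>n0. \<forall>j\<ge>n0. dist (Y (\<sigma> i) t) (Y (\<sigma> j) t) < e"
    proof (intro exI[of _ n0] allI impI)
      fix i j assume "i \<ge> n0" "j \<ge> n0"
      show "dist (Y (\<sigma> i) t) (Y (\<sigma> j) t) < e"
        using n0[OF \<open>i \<ge> n0\<close> \<open>j \<ge> n0\<close>] close[of "\<sigma> i"] close[of "\<sigma> j"]
          dist_triangle3[of "Y (\<sigma> i) t" "Y (\<sigma> j) t" "Y (\<sigma> i) q"]
          dist_triangle[of "Y (\<sigma> i) q" "Y (\<sigma> j) t" "Y (\<sigma> j) q"]
        by (simp add: dist_norm)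
    qed
  qed
  then obtain X where X: "\<And>t. t0 \<le> t \<Longrightarrow> (\<lambda>n. Y (\<sigma> n) t) \<longlonglongrightarrow> X t"
    unfolding convergent_def by metis
  \<comment> \<open>The step values are polygon values at times s that tend to t, and the modulus of
    continuity is common to all polygons, so both sequences have the same limit.\<close>
  have zX: "(\<lambda>n. z (\<sigma> n) t) \<longlonglongrightarrow> X t" if "t0 \<le> t" for t
  proof -
    have "\<exists>s. s \<in> {t0..t} \<and> t - inverse (real (Suc k)) \<le> s \<and> z k t = Y k s" for k
      using z_eq[OF that, of k] unfolding Y_def F_def[abs_def] by blast
    then obtain s where s: "\<And>k. s k \<in> {t0..t}" "\<And>k. t - inverse (real (Suc k)) \<le> s k" "\<And>k. z k t = Y k (s k)"
      by metis
    have "s \<longlonglongrightarrow> t"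
    proof (rule tendsto_sandwich)
      show "(\<lambda>k. t - inverse (real (Suc k))) \<longlonglongrightarrow> t"
        using tendsto_diff[OF tendsto_const LIMSEQ_inverse_real_of_nat, of t] by simp
    qed (use s in auto)
    then have "(\<lambda>n. s (\<sigma> n)) \<longlonglongrightarrow> t"
      using \<open>strict_mono \<sigma>\<close> LIMSEQ_subseq_LIMSEQ[of s t \<sigma>] by (simp add: o_def)
    then have "(\<lambda>n. M (s (\<sigma> n))) \<longlonglongrightarrow> M t"
      using s that by (intro continuous_on_tendsto_compose[OF M_cont[of t]]) auto
    then have lim: "(\<lambda>n. R t * (M t - M (s (\<sigma> n)))) \<longlonglongrightarrow> R t * (M t - M t)"
      by (intro tendsto_intros)
    have "(\<lambda>n. Y (\<sigma> n) t - z (\<sigma> n) t) \<longlonglongrightarrow> 0"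
    proof (rule Lim_null_comparison)
      show "\<forall>\<^sub>F n in sequentially. norm (Y (\<sigma> n) t - z (\<sigma> n) t) \<le> R t * (M t - M (s (\<sigma> n)))"
        using s Y_diff by (intro always_eventually allI) auto
    qed (use lim in simp)
    from tendsto_diff[OF X[OF that] this] show ?thesis by simp
  qed
  have FX: "(\<lambda>n. F (\<sigma> n) t) \<longlonglongrightarrow> G t (X t)" if "t0 \<le> t" for t
    unfolding F_def
    by (rule continuous_on_tendsto_compose[OF cont[OF that] zX[OF that]]) auto
  have mR: "(\<lambda>s. m s * R T) integrable_on {t0..T}" for T
    by (intro integrable_on_mult_left m') auto
  show thesis
  proof (rule that)
    fix T assume T: "t0 \<le> T"
    show "(\<lambda>t. G t (X t)) absolutely_integrable_on {t0..T}"
    proof (rule dominated_convergence_absolutely_integrable[OF F_int[OF T] mR])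
      show "norm (G x (X x)) \<le> m x * R T" if "x \<in> {t0..T}" for x
        by (rule LIMSEQ_le_const2[OF tendsto_norm[OF FX]]) (use that F_bound in auto)
    qed (use FX in auto)
    have "(\<lambda>n. integral {t0..T} (F (\<sigma> n))) \<longlonglongrightarrow> integral {t0..T} (\<lambda>t. G t (X t))"
      by (rule dominated_convergence(2)[OF _ mR])
        (use F_int[OF T] F_bound FX in \<open>auto simp: absolutely_integrable_on_def\<close>)
    then have "(\<lambda>n. Y (\<sigma> n) T) \<longlonglongrightarrow> x0 + integral {t0..T} (\<lambda>t. G t (X t))"
      unfolding Y_def by (intro tendsto_intros)
    then show "X T = x0 + integral {t0..T} (\<lambda>t. G t (X t))"
      using X[OF T] LIMSEQ_unique by blast
  qed
qed

section \<open>The system as one equation for the pair of unknowns\<close>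

lemma bounded_linear_mat: "bounded_linear (\<lambda>c. mat (complex_of_real c) :: complex^'n^'n)"
  unfolding linear_conv_bounded_linear[symmetric]
  by (auto intro!: linearI simp: mat_def vec_eq_iff scaleR_conv_of_real[where 'a=complex])

lemma absolutely_integrable_on_Pair:
  fixes f :: "real \<Rightarrow> 'a::euclidean_space" and g :: "real \<Rightarrow> 'b::euclidean_space"
  assumes "f absolutely_integrable_on S" "g absolutely_integrable_on S"
  shows "(\<lambda>t. (f t, g t)) absolutely_integrable_on S"
proof -
  have "bounded_linear (\<lambda>x::'a. (x, 0::'b))" "bounded_linear (\<lambda>y::'b. (0::'a, y))"
    by (intro bounded_linear_Pair bounded_linear_ident bounded_linear_zero)+
  then have "(\<lambda>t. (f t, 0::'b)) absolutely_integrable_on S" "(\<lambda>t. (0::'a, g t)) absolutely_integrable_on S"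
    using absolutely_integrable_linear[OF assms(1)] absolutely_integrable_linear[OF assms(2)]
    by (force simp: o_def)+
  from set_integral_add(1)[OF this] show ?thesis by simp
qed

text \<open>The bounds on the coefficients hold uniformly in u and v, so the right-hand side grows
  at most linearly in the pair, with a locally integrable factor. Hence solutions exist on the whole
  half-line for arbitrary data at \<open>t0\<close>.\<close>

lemma solution_from_exists:
  fixes A B C :: "real \<Rightarrow> complex^'n \<Rightarrow> complex^'n \<Rightarrow> complex^'n^'n"
  assumes A: "loc_integrable_continuous t0 A" and B: "loc_integrable_continuous t0 B"
    and C: "loc_integrable_continuous t0 C" and \<mu>: "loc_integrable_continuous t0 \<mu>"
    and a0: "locally_integrable_from t0 a0" and b0: "locally_integrable_from t0 b0"
    and c0: "locally_integrable_from t0 c0" and \<mu>0: "locally_integrable_from t0 \<mu>0"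
    and Ab: "\<And>t u v. t0 \<le> t \<Longrightarrow> norm (A t u v) \<le> a0 t"
    and Bb: "\<And>t u v. t0 \<le> t \<Longrightarrow> norm (B t u v) \<le> b0 t"
    and Cb: "\<And>t u v. t0 \<le> t \<Longrightarrow> norm (C t u v) \<le> c0 t"
    and \<mu>b: "\<And>t u v. t0 \<le> t \<Longrightarrow> \<bar>\<mu> t u v\<bar> \<le> \<mu>0 t"
  obtains \<phi> \<psi> where "solution_from t0 A B C \<mu> \<phi> \<psi>" "\<phi> t0 = x0" "\<psi> t0 = y0"
proof -
  define D where "D t u v = mat (complex_of_real (\<mu> t u v)) - ctransp (A t u v)" for t u v
  define G where "G t p = (A t (fst p) (snd p) *v fst p + B t (fst p) (snd p) *v snd p,
      C t (fst p) (snd p) *v fst p + D t (fst p) (snd p) *v snd p)" for t p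
  obtain K where "K > 0" and K: "\<And>(M :: complex^'n^'n) x. norm (M *v x) \<le> norm M * norm x * K"
    using bounded_bilinear.pos_bounded[OF bounded_bilinear_matrix_vector_mult] by blast
  obtain K1 where "K1 > 0" and K1: "\<And>c. norm (mat (complex_of_real c) :: complex^'n^'n) \<le> norm c * K1"
    using bounded_linear.pos_bounded[OF bounded_linear_mat] by blast
  obtain K2 where "K2 > 0" and K2: "\<And>M :: complex^'n^'n. norm (ctransp M) \<le> norm M * K2"
    using bounded_linear.pos_bounded[OF bounded_linear_ctransp] by blast
  \<comment> \<open>The growth factor: \<open>K\<close> belongs to matrix-vector multiplication, and
    the last summand bounds the block \<open>D\<close>, with \<open>K1\<close> and \<open>K2\<close>
    the constants of \<open>mat\<close> and \<open>ctransp\<close>.\<close>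
  define m where "m t = K * (a0 t + b0 t + c0 t + (\<mu>0 t * K1 + a0 t * K2))" for t
  have nonneg: "0 \<le> a0 t" "0 \<le> b0 t" "0 \<le> c0 t" "0 \<le> \<mu>0 t" if "t0 \<le> t" for t
    using Ab[OF that] Bb[OF that] Cb[OF that] \<mu>b[OF that] norm_ge_zero abs_ge_zero order_trans by meson+
  have m_nonneg: "0 \<le> m t" if "t0 \<le> t" for t
    using nonneg[OF that] \<open>K > 0\<close> \<open>K1 > 0\<close> \<open>K2 > 0\<close> by (simp add: m_def)
  have m_int: "m integrable_on {t0..T}" if "t0 \<le> T" for T
    unfolding m_def using a0 b0 c0 \<mu>0 that
    by (intro integrable_on_mult_right integrable_on_mult_left integrable_add)
      (auto simp: locally_integrable_from_def absolutely_integrable_on_def)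
  have Db: "norm (D t u v) \<le> \<mu>0 t * K1 + a0 t * K2" if "t0 \<le> t" for t u v
  proof -
    have "norm (D t u v) \<le> \<bar>\<mu> t u v\<bar> * K1 + norm (A t u v) * K2"
      unfolding D_def using norm_triangle_ineq4 K1[of "\<mu> t u v"] K2[of "A t u v"]
      by (metis add_mono order_trans real_norm_def)
    also have "\<dots> \<le> \<mu>0 t * K1 + a0 t * K2"
      using Ab[OF that] \<mu>b[OF that] \<open>K1 > 0\<close> \<open>K2 > 0\<close> by (intro add_mono mult_right_mono) auto
    finally show ?thesis .
  qed
  have bound: "norm (G t p) \<le> m t * norm p" if "t0 \<le> t" for t p
  proof -
    have mv: "norm (M *v x) \<le> K * b * norm p" if "norm M \<le> b" "norm x \<le> norm p" for M :: "complex^'n^'n" and x b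
    proof -
      have "norm (M *v x) \<le> norm M * norm x * K" by (rule K)
      also have "\<dots> \<le> b * norm p * K"
        using that \<open>K > 0\<close> by (intro mult_right_mono mult_mono) (auto intro: order_trans[OF norm_ge_zero])
      finally show ?thesis by (simp add: mult_ac)
    qed
    have p: "norm (fst p) \<le> norm p" "norm (snd p) \<le> norm p"
      by (cases p, simp add: norm_fst_le norm_snd_le)+
    have "norm (G t p) \<le> norm (fst (G t p)) + norm (snd (G t p))"
      using norm_Pair_le[of "fst (G t p)" "snd (G t p)"] by simp
    also have "\<dots> \<le> (K * a0 t * norm p + K * b0 t * norm p) + (K * c0 t * norm p + K * (\<mu>0 t * K1 + a0 t * K2) * norm p)"
      unfolding G_def fst_conv snd_conv using that p
      by (intro add_mono order_trans[OF norm_triangle_ineq] mv Ab Bb Cb Db)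
    also have "\<dots> = m t * norm p" by (simp add: m_def algebra_simps)
    finally show ?thesis .
  qed
  have int: "(\<lambda>t. G t p) absolutely_integrable_on {t0..T}" if "t0 \<le> T" for p T
  proof -
    have coeff: "(\<lambda>t. F t (fst p) (snd p)) absolutely_integrable_on {t0..T}"
      if "loc_integrable_continuous t0 F" for F :: "real \<Rightarrow> complex^'n \<Rightarrow> complex^'n \<Rightarrow> 'b::euclidean_space"
      using that \<open>t0 \<le> T\<close> by (auto simp: loc_integrable_continuous_def locally_integrable_from_def)
    have mv: "(\<lambda>t. M t *v x) absolutely_integrable_on {t0..T}"
      if "M absolutely_integrable_on {t0..T}" for M :: "real \<Rightarrow> complex^'n^'n" and x
      using absolutely_integrable_linear[OF that
          bounded_bilinear.bounded_linear_left[OF bounded_bilinear_matrix_vector_mult, of x]]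
      by (simp add: o_def)
    have "(\<lambda>t. D t (fst p) (snd p)) absolutely_integrable_on {t0..T}"
      unfolding D_def
      using absolutely_integrable_linear[OF coeff[OF \<mu>] bounded_linear_mat]
        absolutely_integrable_linear[OF coeff[OF A] bounded_linear_ctransp]
      by (intro set_integral_diff(1)) (auto simp: o_def)
    then show ?thesis
      unfolding G_def
      by (intro absolutely_integrable_on_Pair set_integral_add(1) mv coeff[OF A] coeff[OF B] coeff[OF C])
  qed
  have cont: "continuous_on UNIV (G t)" if "t0 \<le> t" for t
  proof -
    have coeff: "continuous_on UNIV (\<lambda>p. F t (fst p) (snd p))"
      if "loc_integrable_continuous t0 F" for F :: "real \<Rightarrow> complex^'n \<Rightarrow> complex^'n \<Rightarrow> 'b::euclidean_space"
      using that \<open>t0 \<le> t\<close> by (auto simp: loc_integrable_continuous_def case_prod_unfold)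
    have "continuous_on UNIV (\<lambda>p. D t (fst p) (snd p))"
      unfolding D_def
      by (intro continuous_on_diff bounded_linear.continuous_on[OF bounded_linear_mat]
          bounded_linear.continuous_on[OF bounded_linear_ctransp] coeff[OF A] coeff[OF \<mu>])
    then show ?thesis
      unfolding G_def
      by (intro continuous_on_Pair continuous_on_add
          bounded_bilinear.continuous_on[OF bounded_bilinear_matrix_vector_mult]
          coeff[OF A] coeff[OF B] coeff[OF C] continuous_on_fst continuous_on_snd continuous_on_id)
  qed
  obtain X where X_int: "\<And>T. t0 \<le> T \<Longrightarrow> (\<lambda>t. G t (X t)) absolutely_integrable_on {t0..T}"
    and X_eq: "\<And>t. t0 \<le> t \<Longrightarrow> X t = (x0, y0) + integral {t0..t} (\<lambda>s. G s (X s))"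
    using caratheodory_existence_linear_growth[OF int cont m_int m_nonneg bound, of "(x0, y0)"] by blast
  define \<phi> \<psi> where "\<phi> t = fst (X t)" and "\<psi> t = snd (X t)" for t
  have X_ac: "abs_continuous_on_interval a b X" if "t0 \<le> a" "a \<le> b" for a b
  \<comment> \<open>From \<open>t0\<close> on, X is a constant plus the indefinite integral, so the
    two have equal increments.\<close>
  proof (rule abs_continuous_on_dominated)
    have "abs_continuous_on_interval t0 b (\<lambda>t. integral {t0..t} (\<lambda>s. G s (X s)))"
      using X_int that by (intro abs_continuous_on_indefinite_integral) auto
    then show ac: "abs_continuous_on_interval a b (\<lambda>t. integral {t0..t} (\<lambda>s. G s (X s)))"
      using that by (auto intro: abs_continuous_on_subinterval)
    then show "abs_continuous_on_interval a b (\<lambda>t. integral {t0..t} (\<lambda>s. G s (X s)))" .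
    fix s r assume "a \<le> s" "s \<le> r" "r \<le> b"
    then show "norm (X r - X s) \<le> 1 *
        (norm (integral {t0..r} (\<lambda>s. G s (X s)) - integral {t0..s} (\<lambda>s. G s (X s))) +
         norm (integral {t0..r} (\<lambda>s. G s (X s)) - integral {t0..s} (\<lambda>s. G s (X s))))"
      using X_eq[of r] X_eq[of s] that by simp
  qed
  have ac: "locally_abs_continuous_from t0 \<phi>" "locally_abs_continuous_from t0 \<psi>"
    unfolding locally_abs_continuous_from_def \<phi>_def \<psi>_def
    using abs_continuous_on_linear[OF bounded_linear_fst X_ac] abs_continuous_on_linear[OF bounded_linear_snd X_ac]
    by simp_all
  obtain N where N: "negligible N" and dX': "\<And>t. t0 \<le> t \<Longrightarrow> t \<notin> N \<Longrightarrow>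
      ((\<lambda>t. integral {t0..t} (\<lambda>s. G s (X s))) has_vector_derivative G t (X t)) (at t within {t0..})"
  proof (rule indefinite_integral_has_vector_derivative_ae[of "\<lambda>s. G s (X s)" t0])
    show "(\<lambda>s. G s (X s)) integrable_on {t0..b}" for b
      using X_int[of b] by (cases "t0 \<le> b") (auto simp: absolutely_integrable_on_def)
  qed blast
  have dX: "(X has_vector_derivative G t (X t)) (at t within {t0..})" if "t0 \<le> t" "t \<notin> N" for t
  proof (rule has_vector_derivative_transform)
    show "((\<lambda>t. (x0, y0) + integral {t0..t} (\<lambda>s. G s (X s))) has_vector_derivative G t (X t)) (at t within {t0..})"
      using has_vector_derivative_add[OF has_vector_derivative_const dX'[OF that]] by simp
  qed (use that X_eq in auto)
  have sol: "solution_from t0 A B C \<mu> \<phi> \<psi>"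
    unfolding solution_from_def eventually_ae_filter_negligible
  proof (intro conjI ac exI[of _ N] N ballI allI impI subsetI)
    fix t assume "t \<in> {t. \<not> (t0 \<le> t \<longrightarrow>
      (\<phi> has_vector_derivative A t (\<phi> t) (\<psi> t) *v \<phi> t + B t (\<phi> t) (\<psi> t) *v \<psi> t) (at t within {t0..}) \<and>
      (\<psi> has_vector_derivative C t (\<phi> t) (\<psi> t) *v \<phi> t +
        (mat (complex_of_real (\<mu> t (\<phi> t) (\<psi> t))) - ctransp (A t (\<phi> t) (\<psi> t))) *v \<psi> t) (at t within {t0..}))}"
    then show "t \<in> N"
      using bounded_linear.has_vector_derivative[OF bounded_linear_fst dX[of t]]
        bounded_linear.has_vector_derivative[OF bounded_linear_snd dX[of t]]
      by (auto simp: \<phi>_def[abs_def] \<psi>_def[abs_def] G_def D_def)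
  qed
  show thesis
    by (rule that[OF sol]) (simp_all add: \<phi>_def \<psi>_def X_eq)
qed

theorem theorem2p1:
  fixes t0 :: real
    and A B C :: "real \<Rightarrow> complex^'n \<Rightarrow> complex^'n \<Rightarrow> complex^'n^'n"
    and \<mu> :: "real \<Rightarrow> complex^'n \<Rightarrow> complex^'n \<Rightarrow> real"
    and a0 b0 c0 \<mu>0 :: "real \<Rightarrow> real"
  assumes "loc_integrable_continuous t0 A"
    and "loc_integrable_continuous t0 B"
    and "loc_integrable_continuous t0 C"
    and "loc_integrable_continuous t0 \<mu>"
    and "\<And>t u v. t0 \<le> t \<Longrightarrow> hermitian (B t u v)"
    and "locally_integrable_from t0 a0"
    and "locally_integrable_from t0 b0"
    and "locally_integrable_from t0 c0"
    and "locally_integrable_from t0 \<mu>0"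
    and "\<And>t u v. t0 \<le> t \<Longrightarrow> norm (A t u v) \<le> a0 t"
    and "\<And>t u v. t0 \<le> t \<Longrightarrow> norm (B t u v) \<le> b0 t"
    and "\<And>t u v. t0 \<le> t \<Longrightarrow> norm (C t u v) \<le> c0 t"
    and "\<And>t u v. t0 \<le> t \<Longrightarrow> \<bar>\<mu> t u v\<bar> \<le> \<mu>0 t"
    and "\<And>t u v. t0 \<le> t \<Longrightarrow> nonneg_definite (B t u v)"
    and "\<And>t u v. t0 \<le> t \<Longrightarrow> nonneg_definite (C t u v + ctransp (C t u v))"
  shows "nonoscillatory_system t0 A B C \<mu>"
  unfolding nonoscillatory_system_def
proof (intro conjI allI impI)
  \<comment> \<open>With \<psi> vanishing at \<open>t0\<close>, the matrix Y = 0 witnesses that the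
    solution is conjoined. Any nonzero value of \<phi> would do; \<open>undefined\<close> is just
    some index.\<close>
  obtain \<phi> \<psi> where sol: "solution_from t0 A B C \<mu> \<phi> \<psi>" "\<phi> t0 = axis undefined 1" "\<psi> t0 = 0"
    using solution_from_exists[OF assms(1-4,6-13)] by metis
  have "nonneg_definite (0 + ctransp (0 :: complex^'n^'n))"
    by (simp add: nonneg_definite_def hermitian_def ctransp_def vec_eq_iff matrix_vector_mult_def)
  with sol have "conjoined_solution t0 A B C \<mu> \<phi> \<psi>"
    unfolding conjoined_solution_def
    by (intro conjI exI[of _ t0] exI[of _ 0]) (auto simp: axis_eq_0_iff)
  then show "nonsingular_system t0 A B C \<mu>"
    unfolding nonsingular_system_def by blast
next
  fix \<phi> \<psi> assume "conjoined_solution t0 A B C \<mu> \<phi> \<psi>"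
  then obtain t1 Y where sol: "solution_from t0 A B C \<mu> \<phi> \<psi>" and "t0 \<le> t1"
    and Y: "nonneg_definite (Y + ctransp Y)" and "\<phi> t1 \<noteq> 0" and "\<psi> t1 = Y *v \<phi> t1"
    unfolding conjoined_solution_def by blast
  moreover have "0 \<le> \<phi> t1 \<bullet> \<psi> t1"
    unfolding \<open>\<psi> t1 = Y *v \<phi> t1\<close> by (rule nonneg_definite_add_ctransp_inner[OF Y])
  ultimately have "\<forall>t\<ge>t1. \<phi> t \<noteq> 0"
    using solution_from_nonzero[OF sol _ _ _ _ assms(6,9,10,13,14,15)] by blast
  with sol \<open>t0 \<le> t1\<close> show "nonoscillatory_solution t0 A B C \<mu> \<phi> \<psi>"
    unfolding nonoscillatory_solution_def by blast
qed

end
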